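(* Let $X$ be an infinite-dimensional Banach space. Then there exists an infinite-dimensional closed subspace $Y$ of $X$ such that either $Y$ has an unconditional basis or $Y$ is hereditarily indecomposable.
   Context: A Banach space is hereditarily indecomposable if none of its infinite-dimensional subspaces is isomorphic to a topological direct sum of two infinite-dimensional subspaces. A sequence $(x_n)$ is unconditional if there exists a constant $C$ such that for all (convergent) series $\sum_{n} a_n x_n$ and all signs $\varepsilon_n\in\{-1,1\}$ one has $\|\sum_{n}\varepsilon_n a_n x_n\|\le C\|\sum_{n} a_n x_n\|$. An unconditional basis is a Schauder basis that is unconditional. *)

theory Defs
  imports "HOL-Analysis.Analysis"
begin

text \<open>
  The scalar field is a type of class \<open>{real_normed_field, euclidean_space}\<close>. Both \<open>real\<close> and
  \<open>complex\<close> are instances, and by the Gelfand--Mazur theorem every instance is isometrically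
  isomorphic to one of them. Subspaces, spans, coefficients and isomorphisms are all taken with
  respect to \<open>scale\<close>; for complex scalars \<open>scaleR\<close> is its restriction to the reals.
\<close>

locale normed_space_over = vector_space scale
  for scale :: "'k::{real_normed_field,euclidean_space} \<Rightarrow> 'a::real_normed_vector \<Rightarrow> 'a"
    (infixr \<open>*k\<close> 75) +
  assumes norm_scale: "norm (c *k x) = norm c * norm x"
    and scale_of_real: "of_real r *k x = r *\<^sub>R x"
begin

definition infinite_dimensional :: "'a set \<Rightarrow> bool" where
  "infinite_dimensional S \<longleftrightarrow> \<not> (\<exists>B. finite B \<and> S \<subseteq> span B)"

definition schauder_basis :: "'a set \<Rightarrow> (nat \<Rightarrow> 'a) \<Rightarrow> bool" where
  "schauder_basis Y e \<longleftrightarrow>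
     range e \<subseteq> Y \<and> (\<forall>y\<in>Y. \<exists>!a. (\<lambda>n. a n *k e n) sums y)"

text \<open>
  The convergence of the signed series is part of the requirement, since \<open>suminf\<close> is
  meaningless on divergent series.
\<close>

definition unconditional :: "(nat \<Rightarrow> 'a) \<Rightarrow> bool" where
  "unconditional x \<longleftrightarrow>
     (\<exists>C. \<forall>a \<epsilon>. summable (\<lambda>n. a n *k x n) \<longrightarrow> range \<epsilon> \<subseteq> {-1, 1} \<longrightarrow>
        summable (\<lambda>n. (\<epsilon> n * a n) *k x n) \<and>
        norm (\<Sum>n. (\<epsilon> n * a n) *k x n) \<le> C * norm (\<Sum>n. a n *k x n))"

definition has_unconditional_basis :: "'a set \<Rightarrow> bool" where
  "has_unconditional_basis Y \<longleftrightarrow> (\<exists>e. schauder_basis Y e \<and> unconditional e)"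

text \<open>
  The topological direct sum of \<open>U\<close> and \<open>V\<close> is the product \<open>U \<times> V\<close> with componentwise operations
  and the product topology; an isomorphism is a linear homeomorphism.
\<close>

definition isomorphic_to_direct_sum :: "'a set \<Rightarrow> 'a set \<Rightarrow> 'a set \<Rightarrow> bool" where
  "isomorphic_to_direct_sum W U V \<longleftrightarrow>
     (\<exists>f g. homeomorphism (U \<times> V) W f g \<and>
        (\<forall>p\<in>U \<times> V. \<forall>q\<in>U \<times> V. f (p + q) = f p + f q) \<and>
        (\<forall>c. \<forall>u\<in>U. \<forall>v\<in>V. f (c *k u, c *k v) = c *k f (u, v)))"

text \<open>
  Here \<open>U\<close>, \<open>V\<close> and \<open>W\<close> are arbitrary linear subspaces. For a closed subspace \<open>Y\<close> of a
  Banach space, requiring them to be closed yields the same notion, because an isomorphism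
  extends to the closures.
\<close>

definition hereditarily_indecomposable :: "'a set \<Rightarrow> bool" where
  "hereditarily_indecomposable Y \<longleftrightarrow>
     \<not> (\<exists>W U V. subspace W \<and> W \<subseteq> Y \<and> infinite_dimensional W \<and>
           subspace U \<and> U \<subseteq> Y \<and> infinite_dimensional U \<and>
           subspace V \<and> V \<subseteq> Y \<and> infinite_dimensional V \<and>
           isomorphic_to_direct_sum W U V)"

end

lemma normed_space_over_scaleR:
  "normed_space_over (scaleR :: real \<Rightarrow> 'a::real_normed_vector \<Rightarrow> 'a)"
  by unfold_locales (simp_all add: algebra_simps)

lemma normed_space_over_complex:
  "normed_space_over ((*) :: complex \<Rightarrow> complex \<Rightarrow> complex)"
  by unfold_locales (simp_all add: algebra_simps norm_mult scaleR_conv_of_real)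

end

theory Submission
  imports Defs
begin

text \<open>
  This is Maurey's proof of Gowers' dichotomy. Fix \<open>\<epsilon> > 0\<close> and call a pair \<open>(A, B)\<close> of finite sets of
  vectors accepted by a subspace \<open>Z\<close> if for all infinite-dimensional subspaces \<open>U\<close>, \<open>V\<close> of \<open>Z\<close> there are
  \<open>x\<close> in the span of \<open>A \<union> U\<close> and \<open>y\<close> in the span of \<open>B \<union> V\<close> with \<open>norm (x - y) < \<epsilon> * norm (x + y)\<close>, and
  rejected if no infinite-dimensional subspace of \<open>Z\<close> accepts it. Acceptance survives finite-codimensional
  changes of \<open>Z\<close>, so a diagonal argument produces a \<open>Z\<close> which accepts or rejects each of the countably many
  pairs that occur, simultaneously for all \<open>\<epsilon> = 1 / (n + 1)\<close>. If the empty pair is accepted for all these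
  \<open>\<epsilon>\<close>, two infinite-dimensional subspaces of the closure of \<open>Z\<close> can be perturbed into \<open>Z\<close> and hence are never
  at a positive angle. If it is rejected for some \<open>\<epsilon>\<close>, rejected pairs can be extended vector by vector, which
  yields a sequence all of whose splittings into two parts are rejected, and this sequence is unconditional
  with constant \<open>1 / \<epsilon>\<close>.
\<close>

section \<open>Countable sets closed under countably many operations\<close>

lemma countable_closed_superset:
  fixes S :: "'b set" and F :: "('b \<Rightarrow> 'b \<Rightarrow> 'b) set"
  assumes "countable S" "countable F"
  obtains T where "S \<subseteq> T" "countable T" "\<And>f x y. f \<in> F \<Longrightarrow> x \<in> T \<Longrightarrow> y \<in> T \<Longrightarrow> f x y \<in> T"
proof -
  \<comment> \<open>One round adds all values on pairs; arguments from different rounds both lie in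
    the later one, so their value appears one round after it. Unary operations enter as binary ones
    that ignore an argument.\<close>
  define step where "step A = A \<union> (\<lambda>(f,x,y). f x y) ` (F \<times> A \<times> A)" for A
  define T where "T = (\<Union>n. (step ^^ n) S)"
  have "countable ((step ^^ n) S)" for n
    by (induction n) (auto simp: assms step_def intro!: countable_SIGMA countable_image)
  then have T: "countable T" by (auto simp: T_def)
  have mono: "m \<le> n \<Longrightarrow> (step ^^ m) S \<subseteq> (step ^^ n) S" for m n
    by (induction n rule: dec_induct) (auto simp: step_def)
  have "f x y \<in> T" if f: "f \<in> F" and xT: "x \<in> T" and yT: "y \<in> T" for f x y
  proof -
    obtain m n where "x \<in> (step ^^ m) S" "y \<in> (step ^^ n) S"
      using xT yT by (auto simp: T_def)
    then have "x \<in> (step ^^ max m n) S" "y \<in> (step ^^ max m n) S"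
      using mono[of m "max m n"] mono[of n "max m n"] by auto
    then have "f x y \<in> (step ^^ Suc (max m n)) S"
      using f by (auto simp: step_def intro!: image_eqI[of _ _ "(f, x, y)"])
    then show ?thesis by (auto simp: T_def simp del: funpow.simps)
  qed
  moreover have "S \<subseteq> T" unfolding T_def by (rule order_trans[OF _ UN_upper[of 0]]) auto
  ultimately show ?thesis using that T by blast
qed

subsection \<open>Norming functionals\<close>

text \<open>One inequality for \<open>t > 0\<close> is all that positive homogeneity requires:
  applied to \<open>1/t\<close> it yields the other, which is how \<open>sublinearD\<close> gets
  equality.\<close>

definition sublinear :: "('a::real_vector \<Rightarrow> real) \<Rightarrow> bool" where
  "sublinear q \<longleftrightarrow> q 0 = 0 \<and> (\<forall>x y. q (x + y) \<le> q x + q y) \<and> (\<forall>t>0. \<forall>x. q (t *\<^sub>R x) \<le> t * q x)"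

lemma sublinearD:
  assumes "sublinear q"
  shows "q 0 = 0" "q (x + y) \<le> q x + q y" "t \<ge> 0 \<Longrightarrow> q (t *\<^sub>R x) = t * q x" "- q (- x) \<le> q x"
proof -
  show 0: "q 0 = 0" and add: "q (x + y) \<le> q x + q y" for x y
    using assms by (auto simp: sublinear_def)
  show "- q (- x) \<le> q x" using add[of x "-x"] 0 by simp
  have le: "t > 0 \<Longrightarrow> q (t *\<^sub>R x) \<le> t * q x" for t x using assms by (auto simp: sublinear_def)
  have "q (t *\<^sub>R x) = t * q x" if "t > 0"
  proof -
    have "q ((1/t) *\<^sub>R (t *\<^sub>R x)) \<le> (1/t) * q (t *\<^sub>R x)" using that by (intro le) auto
    then have "t * q x \<le> q (t *\<^sub>R x)" using that by (simp add: field_simps)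
    then show ?thesis using le[OF that, of x] by simp
  qed
  then show "t \<ge> 0 \<Longrightarrow> q (t *\<^sub>R x) = t * q x" using 0 by (cases "t = 0") auto
qed

text \<open>The standard auxiliary functional of the Hahn-Banach proof. It lies below
  \<open>q\<close> (take \<open>t = 0\<close>) and is at most \<open>q (x + y) - q y\<close> (take
  \<open>t = 1\<close>), so a minimal sublinear \<open>q\<close>, which must agree with it, is
  superadditive.\<close>

definition sublinear_shift :: "('a::real_vector \<Rightarrow> real) \<Rightarrow> 'a \<Rightarrow> 'a \<Rightarrow> real" where
  "sublinear_shift q y x = (INF t\<in>{0..}. q (x + t *\<^sub>R y) - t * q y)"

lemma sublinear_shift_le:
  assumes "sublinear q" "t \<ge> 0"
  shows "sublinear_shift q y x \<le> q (x + t *\<^sub>R y) - t * q y"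
  unfolding sublinear_shift_def
proof (rule cINF_lower)
  show "bdd_below ((\<lambda>t. q (x + t *\<^sub>R y) - t * q y) ` {0..})"
  proof (rule bdd_belowI2)
    fix t :: real assume "t \<in> {0..}"
    then show "- q (- x) \<le> q (x + t *\<^sub>R y) - t * q y"
      using sublinearD(2)[OF assms(1), of "x + t *\<^sub>R y" "- x"] sublinearD(3)[OF assms(1), of t y] by simp
  qed
qed (use assms in auto)

lemma sublinear_shift:
  assumes q: "sublinear q"
  shows "sublinear (sublinear_shift q y)"
proof -
  have ge: "c \<le> sublinear_shift q y x" if "\<And>t. t \<ge> 0 \<Longrightarrow> c \<le> q (x + t *\<^sub>R y) - t * q y" for c x
    unfolding sublinear_shift_def by (rule cINF_greatest) (use that in auto)
  have 0: "sublinear_shift q y 0 = 0"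
  proof (rule antisym)
    show "sublinear_shift q y 0 \<le> 0" using sublinear_shift_le[OF q, of 0 y 0] sublinearD(1)[OF q] by simp
    show "0 \<le> sublinear_shift q y 0" by (rule ge) (simp add: sublinearD(3)[OF q])
  qed
  have add: "sublinear_shift q y (x + x') \<le> sublinear_shift q y x + sublinear_shift q y x'" for x x'
  proof -
    have "sublinear_shift q y (x + x') - (q (x' + s *\<^sub>R y) - s * q y) \<le> q (x + t *\<^sub>R y) - t * q y"
      if "s \<ge> 0" "t \<ge> 0" for s t
      using sublinear_shift_le[OF q, of "t + s" y "x + x'"] that
        sublinearD(2)[OF q, of "x + t *\<^sub>R y" "x' + s *\<^sub>R y"]
      by (simp add: algebra_simps)
    then have "sublinear_shift q y (x + x') - (q (x' + s *\<^sub>R y) - s * q y) \<le> sublinear_shift q y x"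
      if "s \<ge> 0" for s using that by (intro ge) auto
    then have "sublinear_shift q y (x + x') - sublinear_shift q y x \<le> sublinear_shift q y x'"
      by (intro ge) (simp add: algebra_simps)
    then show ?thesis by simp
  qed
  have "sublinear_shift q y (s *\<^sub>R x) \<le> s * sublinear_shift q y x" if "s > 0" for s x
  proof -
    have "sublinear_shift q y (s *\<^sub>R x) / s \<le> sublinear_shift q y x"
    proof (rule ge)
      fix t :: real assume "t \<ge> 0"
      then have "sublinear_shift q y (s *\<^sub>R x) \<le> s * (q (x + t *\<^sub>R y) - t * q y)"
        using sublinear_shift_le[OF q, of "s * t" y "s *\<^sub>R x"] that
          sublinearD(3)[OF q, of s "x + t *\<^sub>R y"] by (simp add: algebra_simps)
      then show "sublinear_shift q y (s *\<^sub>R x) / s \<le> q (x + t *\<^sub>R y) - t * q y"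
        using that by (simp add: divide_le_eq mult.commute)
    qed
    then show ?thesis using that by (simp add: divide_le_eq mult.commute)
  qed
  with 0 add show ?thesis by (auto simp: sublinear_def)
qed

text \<open>Hahn-Banach in the form that a minimal sublinear functional is linear. Zorn's lemma
  provides a minimal one below \<open>p\<close>; its shifts cannot lie strictly below it, and this
  turns subadditivity into additivity.\<close>

lemma linear_minorant_of_sublinear:
  fixes p :: "'a::real_vector \<Rightarrow> real"
  assumes p: "sublinear p"
  obtains f where "linear f" "\<And>x. f x \<le> p x"
proof -
  define A where "A = {q. sublinear q \<and> (\<forall>x. q x \<le> p x)}"
  \<comment> \<open>The order is reversed, so that the maximal element from Zorn's lemma is a
    minimal functional.\<close>
  define P where "P q r \<longleftrightarrow> (\<forall>x. r x \<le> q x)" for q r :: "'a \<Rightarrow> real"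
  have "\<exists>m\<in>A. \<forall>a\<in>A. P m a \<longrightarrow> a = m"
  proof (rule predicate_Zorn)
    show "partial_order_on A (relation_of P A)"
      by (rule partial_order_on_relation_ofI) (auto simp: P_def fun_eq_iff intro: order_trans antisym)
    fix C assume "C \<in> Chains (relation_of P A)"
    then have CA: "C \<subseteq> A" and chain: "\<And>q r. q \<in> C \<Longrightarrow> r \<in> C \<Longrightarrow> P q r \<or> P r q"
      unfolding Chains_def relation_of_def by blast+
    show "\<exists>u\<in>A. \<forall>a\<in>C. P a u"
    proof (cases "C = {}")
      case True then show ?thesis using p by (auto simp: A_def)
    next
      case False
      have sub: "sublinear q" "q x \<le> p x" if "q \<in> C" for q x using that CA by (auto simp: A_def)
      define u where "u x = (INF q\<in>C. q x)" for x
      have le: "u x \<le> q x" if "q \<in> C" for q x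
        unfolding u_def
      proof (rule cINF_lower[OF _ that], rule bdd_belowI2)
        show "- p (- x) \<le> r x" if "r \<in> C" for r
          using sublinearD(4)[OF sub(1)[OF that], of x] sub(2)[OF that, of "-x"] by simp
      qed
      have ge: "c \<le> u x" if "\<And>q. q \<in> C \<Longrightarrow> c \<le> q x" for c x
        unfolding u_def by (rule cINF_greatest) (use that False in auto)
      have "u 0 = 0"
        using le[of _ 0] ge[of 0 0] sublinearD(1)[OF sub(1)] False by (metis antisym ex_in_conv order_refl)
      moreover have "u (x + y) \<le> u x + u y" for x y
      proof -
        \<comment> \<open>An infimum of subadditive functionals need not be subadditive;
          comparability in the chain supplies a single member below \<open>q\<close> at
          \<open>x\<close> and below \<open>r\<close> at \<open>y\<close>.\<close>
        have *: "u (x + y) \<le> q x + r y" if "q \<in> C" "r \<in> C" for q r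
        proof -
          have "\<exists>s\<in>C. s x \<le> q x \<and> s y \<le> r y" using chain[OF that] that by (auto simp: P_def)
          then obtain s where "s \<in> C" "s x \<le> q x" "s y \<le> r y" by auto
          then show ?thesis using le[of s "x + y"] sublinearD(2)[OF sub(1), of s x y] by fastforce
        qed
        have "u (x + y) - q x \<le> u y" if "q \<in> C" for q
          by (intro ge) (use *[OF that] in \<open>simp add: diff_le_eq add.commute\<close>)
        then have "u (x + y) - u y \<le> u x" by (intro ge) (simp add: algebra_simps)
        then show ?thesis by simp
      qed
      moreover have "u (t *\<^sub>R x) \<le> t * u x" if "t > 0" for t x
      proof -
        have "u (t *\<^sub>R x) / t \<le> u x"
          using le[of _ "t *\<^sub>R x"] sublinearD(3)[OF sub(1), of _ t x] that
          by (intro ge) (fastforce simp: divide_le_eq mult.commute)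
        then show ?thesis using that by (simp add: divide_le_eq mult.commute)
      qed
      ultimately have "sublinear u" by (auto simp: sublinear_def)
      moreover have "u x \<le> p x" for x using False le[of _ x] sub(2)[of _ x] by (meson ex_in_conv order_trans)
      ultimately show ?thesis using le by (auto simp: A_def P_def)
    qed
  qed
  then obtain m where m: "sublinear m" "\<And>x. m x \<le> p x"
    and min: "\<And>a. sublinear a \<Longrightarrow> (\<And>x. a x \<le> p x) \<Longrightarrow> (\<And>x. a x \<le> m x) \<Longrightarrow> a = m"
    unfolding A_def P_def by blast
  have "sublinear_shift m y = m" for y
  proof (rule min)
    show "sublinear (sublinear_shift m y)" by (rule sublinear_shift[OF m(1)])
    show le: "sublinear_shift m y x \<le> m x" for x using sublinear_shift_le[OF m(1), of 0 y x] by simp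
    show "sublinear_shift m y x \<le> p x" for x using le[of x] m(2)[of x] by simp
  qed
  then have "m x \<le> m (x + y) - m y" for x y
    using sublinear_shift_le[OF m(1), of 1 y x] by simp
  then have add: "m (x + y) = m x + m y" for x y
    using sublinearD(2)[OF m(1), of x y] by (smt (verit))
  have neg: "m (- x) = - m x" for x using add[of x "-x"] sublinearD(1)[OF m(1)] by simp
  have "m (t *\<^sub>R x) = t * m x" for t x
    using sublinearD(3)[OF m(1), of t x] sublinearD(3)[OF m(1), of "-t" x] neg[of "t *\<^sub>R x"]
    by (cases "t \<ge> 0") auto
  then have "linear m" by (intro linearI) (auto simp: add)
  then show ?thesis using that m(2) by blast
qed

text \<open>Instead of extending a functional from the line through \<open>u\<close>, take a linear
  minorant of the norm shifted by \<open>u\<close>: its value at \<open>- u\<close> is at most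
  \<open>- norm u\<close>. The functional is only real-linear, also over complex scalars.\<close>

lemma norming_functional:
  fixes u :: "'a::real_normed_vector"
  obtains f where "linear f" "\<And>x. \<bar>f x\<bar> \<le> norm x" "f u = norm u"
proof -
  have n: "sublinear (norm :: 'a \<Rightarrow> real)" by (auto simp: sublinear_def norm_triangle_ineq)
  obtain f where f: "linear f" "\<And>x. f x \<le> sublinear_shift norm u x"
    using linear_minorant_of_sublinear[OF sublinear_shift[OF n]] by blast
  have le: "f x \<le> norm x" for x using f(2)[of x] sublinear_shift_le[OF n, of 0 u x] by simp
  have neg: "f (- x) = - f x" for x using linear_neg[OF f(1)] .
  have "\<bar>f x\<bar> \<le> norm x" for x using le[of x] le[of "-x"] neg[of x] by simp
  moreover have "f u = norm u"
    using f(2)[of "-u"] sublinear_shift_le[OF n, of 1 u "-u"] le[of u] neg[of u] by simp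
  ultimately show ?thesis using that f(1) by blast
qed

text \<open>Scaling \<open>x\<close> to norm \<open>d / 2\<close> turns continuity at 0 into a
  bound. Real homogeneity on a set is the form in which both an isomorphism of a direct sum and its
  inverse are available.\<close>

lemma continuous_homogeneous_bounded:
  fixes f :: "'b::real_normed_vector \<Rightarrow> 'c::real_normed_vector"
  assumes "continuous_on S f" "0 \<in> S" and S: "\<And>r x. x \<in> S \<Longrightarrow> r *\<^sub>R x \<in> S"
    and f: "\<And>r x. x \<in> S \<Longrightarrow> f (r *\<^sub>R x) = r *\<^sub>R f x"
  obtains M where "M > 0" "\<And>x. x \<in> S \<Longrightarrow> norm (f x) \<le> M * norm x"
proof -
  have 0: "f 0 = 0" using f[of 0 0] assms(2) by simp
  obtain d where d: "d > 0" "\<And>x. x \<in> S \<Longrightarrow> norm x < d \<Longrightarrow> norm (f x) < 1"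
    using assms(1,2) unfolding continuous_on_iff
    by (metis 0 dist_0_norm dist_commute zero_less_one)
  have "norm (f x) \<le> (2 / d) * norm x" if x: "x \<in> S" for x
  proof (cases "x = 0")
    case True then show ?thesis using 0 by simp
  next
    case False
    define r where "r = d / (2 * norm x)"
    have r: "r > 0" using False d by (simp add: r_def)
    have "norm (r *\<^sub>R x) < d" using d False by (simp add: r_def)
    then have "norm (f (r *\<^sub>R x)) < 1" using d(2) S x by blast
    then have "r * norm (f x) < 1" using f[OF x] r by simp
    then show ?thesis using d False by (simp add: r_def field_simps)
  qed
  then show ?thesis using that[of "2 / d"] d by simp
qed

subsection \<open>Sequences with bounded coordinates\<close>

context normed_space_over
begin

section \<open>Infinite dimension and free sequences\<close>

lemma infinite_dimensional_mono:
  "infinite_dimensional S \<Longrightarrow> S \<subseteq> T \<Longrightarrow> infinite_dimensional T"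
  by (auto simp: infinite_dimensional_def)

lemma infinite_dimensional_finite_codim:
  assumes "infinite_dimensional U" "finite B" "U \<subseteq> span (S \<union> B)"
  shows "infinite_dimensional S"
  unfolding infinite_dimensional_def
proof
  assume "\<exists>B'. finite B' \<and> S \<subseteq> span B'"
  then obtain B' where B': "finite B'" "S \<subseteq> span B'" by auto
  have "S \<union> B \<subseteq> span (B' \<union> B)"
    using B'(2) span_mono[of B' "B' \<union> B"] span_superset[of "B' \<union> B"] by auto
  then have "span (S \<union> B) \<subseteq> span (B' \<union> B)" by (simp add: span_minimal)
  with assms B' show False unfolding infinite_dimensional_def
    by (metis finite_UnI order_trans)
qed

text \<open>The sets vary with the index so that the diagonal argument can take its n-th vector from
  the n-th subspace.\<close>

lemma free_sequence_exists:
  assumes "\<And>n. infinite_dimensional (Z n)"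
  obtains z where "\<And>n::nat. z n \<in> Z n" "\<And>n. z n \<notin> span (z ` {..<n})"
proof -
  have "\<exists>z. \<forall>n::nat. z n \<in> Z n \<and> z n \<notin> span (z ` {..<n})"
  proof (rule dependent_wellorder_choice)
    fix r and f g :: "nat \<Rightarrow> 'a" and x assume "\<And>y. y < x \<Longrightarrow> f y = g y"
    then have "f ` {..<x} = g ` {..<x}" by (intro image_cong) auto
    then show "(r \<in> Z x \<and> r \<notin> span (f ` {..<x})) = (r \<in> Z x \<and> r \<notin> span (g ` {..<x}))" by simp
  next
    fix x and f :: "nat \<Rightarrow> 'a"
    show "\<exists>r. r \<in> Z x \<and> r \<notin> span (f ` {..<x})"
      using assms[of x] unfolding infinite_dimensional_def by blast
  qed
  then show ?thesis using that by blast
qed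

text \<open>Initial segments are independent sets of every finite size, more than a finite spanning
  set allows.\<close>

lemma infinite_dimensional_free_sequence:
  assumes z: "\<And>n::nat. z n \<notin> span (z ` {..<n})"
  shows "infinite_dimensional (range z)"
proof -
  have *: "independent (z ` {..<n}) \<and> card (z ` {..<n}) = n" for n
  proof (induction n)
    case (Suc n)
    have "z n \<notin> z ` {..<n}" using z[of n] span_base by auto
    then show ?case using Suc z[of n] by (simp add: lessThan_Suc independent_insert)
  qed (simp add: independent_empty)
  show ?thesis
    unfolding infinite_dimensional_def
  proof
    assume "\<exists>B. finite B \<and> range z \<subseteq> span B"
    then obtain B where B: "finite B" "range z \<subseteq> span B" by auto
    have "card (z ` {..<Suc (card B)}) \<le> card B"
      using independent_span_bound[OF B(1), of "z ` {..<Suc (card B)}"] * B(2) by auto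
    then show False using *[of "Suc (card B)"] by simp
  qed
qed

section \<open>Finite linear combinations of a sequence\<close>

lemma sum_pad:
  fixes a :: "nat \<Rightarrow> 'k"
  assumes "N \<le> (M::nat)"
  shows "(\<Sum>i<N. a i *k w i) = (\<Sum>i<M. (if i < N then a i else 0) *k w i)"
proof -
  have "(\<Sum>i<M. (if i < N then a i else 0) *k w i) = (\<Sum>i<M. if i \<in> {..<N} then a i *k w i else 0)"
    by (intro sum.cong) auto
  also have "\<dots> = (\<Sum>i\<in>{..<M} \<inter> {..<N}. a i *k w i)" by (rule sum.inter_restrict[symmetric]) simp
  also have "{..<M} \<inter> {..<N} = {..<N}" using assms by auto
  finally show ?thesis by simp
qed

lemma sum_add_pad:
  fixes a b :: "nat \<Rightarrow> 'k"
  shows "(\<Sum>i<N. a i *k w i) + (\<Sum>i<M. b i *k w i) =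
     (\<Sum>i<max N M. ((if i < N then a i else 0) + (if i < M then b i else 0)) *k w i)"
  unfolding scale_left_distrib sum.distrib
  using sum_pad[of N "max N M" a w] sum_pad[of M "max N M" b w] by simp

lemma span_range_sum:
  assumes "x \<in> span (range w)"
  obtains a N where "x = (\<Sum>i<N::nat. a i *k w i)"
proof -
  define S where "S = {x. \<exists>a N. x = (\<Sum>i<N::nat. a i *k w i)}"
  have "0 \<in> S" unfolding S_def by (auto intro!: exI[of _ 0])
  moreover have "x + y \<in> S" if "x \<in> S" "y \<in> S" for x y
  proof -
    from that obtain a N b M where "x = (\<Sum>i<N::nat. a i *k w i)" "y = (\<Sum>i<M::nat. b i *k w i)"
      by (auto simp: S_def)
    moreover define c where "c i = (if i < N then a i else 0) + (if i < M then b i else 0)" for i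
    ultimately have "x + y = (\<Sum>i<max N M. c i *k w i)" by (simp only: sum_add_pad c_def)
    then show ?thesis unfolding S_def by blast
  qed
  moreover have "c *k x \<in> S" if "x \<in> S" for c x
  proof -
    from that obtain a N where "x = (\<Sum>i<N::nat. a i *k w i)" by (auto simp: S_def)
    then have "c *k x = (\<Sum>i<N::nat. (c * a i) *k w i)" by (simp add: scale_sum_right)
    then show ?thesis by (auto simp: S_def)
  qed
  ultimately have S: "subspace S" by (auto simp: subspace_def)
  have "w n \<in> S" for n
  proof -
    define c where "c i = (if i = n then 1 else 0 :: 'k)" for i
    have "w n = (\<Sum>i<Suc n. c i *k w i)" by (simp add: c_def)
    then show ?thesis unfolding S_def by blast
  qed
  then have "span (range w) \<subseteq> S" using S by (intro span_minimal) auto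
  with assms that show ?thesis by (auto simp: S_def)
qed

lemma span_initial_segment_sum:
  assumes "x \<in> span (w ` {..<n})"
  obtains a where "x = (\<Sum>i<n::nat. a i *k w i)"
proof -
  have "\<exists>a. x = (\<Sum>i<n::nat. a i *k w i)"
    using assms
  proof (induction n arbitrary: x)
    case (Suc n)
    then obtain c where "x - c *k w n \<in> span (w ` {..<n})"
      by (auto simp: lessThan_Suc span_insert)
    then obtain a where "x - c *k w n = (\<Sum>i<n. a i *k w i)" using Suc by blast
    then have "x = (\<Sum>i<Suc n. (a(n := c)) i *k w i)" by (simp add: algebra_simps)
    then show ?case by blast
  qed auto
  then show ?thesis using that by blast
qed

section \<open>Real-linear functionals over general scalars\<close>

lemma scaleR_left_scale: "(r *\<^sub>R c) *k x = r *\<^sub>R (c *k x)"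
  by (metis scale_of_real scale_scale scaleR_conv_of_real)

lemma scale_scaleR: "c *k (r *\<^sub>R x) = r *\<^sub>R (c *k x)"
  by (metis scale_of_real scale_scale mult.commute)

lemma span_scaleR: "x \<in> span S \<Longrightarrow> r *\<^sub>R x \<in> span S"
  by (metis scale_of_real span_scale)

lemma subspace_scaleR: "subspace S \<Longrightarrow> x \<in> S \<Longrightarrow> r *\<^sub>R x \<in> S"
  by (metis scale_of_real subspace_scale)

text \<open>Each further kernel costs at most one vector: if \<open>g j t\<close> is nonzero,
  subtracting a real multiple of \<open>t\<close> moves any vector of the previous kernel into the
  new one. Kernels are merely real subspaces, while dimension is counted over
  \<open>'k\<close>.\<close>

lemma infinite_dimensional_kernels:
  assumes "finite I" "real_vector.subspace U" "infinite_dimensional U"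
    and g: "\<And>i. i \<in> I \<Longrightarrow> linear (g i :: 'a \<Rightarrow> real)"
  shows "infinite_dimensional {x \<in> U. \<forall>i\<in>I. g i x = 0}"
  using assms(1) g
proof (induction I)
  case empty then show ?case using assms by simp
next
  case (insert j I)
  define N where "N = {x \<in> U. \<forall>i\<in>I. g i x = 0}"
  have N: "infinite_dimensional N" using insert by (auto simp: N_def)
  define N' where "N' = {x \<in> N. g j x = 0}"
  have lin: "linear (g i)" if "i \<in> insert j I" for i using insert.prems that by blast
  have "\<exists>t. N \<subseteq> span (N' \<union> {t})"
  proof (cases "N \<subseteq> N'")
    case True then show ?thesis using span_superset[of "N' \<union> _"] by blast
  next
    case False
    then obtain t where t: "t \<in> N" "g j t \<noteq> 0" by (auto simp: N'_def)
    have "x \<in> span (N' \<union> {t})" if x: "x \<in> N" for x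
    proof -
      define r where "r = g j x / g j t"
      have "x - r *\<^sub>R t \<in> U" using x t assms(2)
        by (auto simp: N_def intro: real_vector.subspace_diff real_vector.subspace_scale)
      moreover have "g i (x - r *\<^sub>R t) = 0" if "i \<in> I" for i
        using x t that lin[of i] by (simp add: N_def linear_diff linear_scale)
      moreover have "g j (x - r *\<^sub>R t) = 0"
        using t lin[of j] by (simp add: r_def linear_diff linear_scale)
      ultimately have "x - r *\<^sub>R t \<in> N'" by (simp add: N_def N'_def)
      then have "(x - r *\<^sub>R t) + r *\<^sub>R t \<in> span (N' \<union> {t})"
        by (intro span_add span_scaleR) (auto intro: span_base)
      then show ?thesis by simp
    qed
    then show ?thesis by blast
  qed
  then have "infinite_dimensional N'"
    using infinite_dimensional_finite_codim[OF N] by blast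
  moreover have "N' = {x \<in> U. \<forall>i\<in>insert j I. g i x = 0}" by (auto simp: N'_def N_def)
  ultimately show ?case by simp
qed

text \<open>Quantifying over \<open>c\<close> makes the kernel of a real functional closed under
  scalars from \<open>'k\<close>. Expanding \<open>c\<close> in the finite real basis of
  \<open>'k\<close> reduces this to finitely many kernels.\<close>

lemma infinite_dimensional_annihilated_part:
  assumes U: "subspace U" "infinite_dimensional U" and f: "linear (f :: 'a \<Rightarrow> real)"
  shows "subspace {x \<in> U. \<forall>c. f (c *k x) = 0}"
    and "infinite_dimensional {x \<in> U. \<forall>c. f (c *k x) = 0}"
proof -
  show "subspace {x \<in> U. \<forall>c. f (c *k x) = 0}"
    using U(1) f by (auto simp: subspace_def scale_right_distrib linear_add linear_0)
  have lin: "linear (\<lambda>x. f (c *k x))" for c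
    using f by (intro linearI) (simp_all add: scale_right_distrib linear_add scale_scaleR linear_scale)
  have "f (c *k x) = 0" if "\<forall>b\<in>Basis. f (b *k x) = 0" for c x
  proof -
    have "f ((\<Sum>b\<in>Basis. (c \<bullet> b) *\<^sub>R b) *k x) = (\<Sum>b\<in>Basis. (c \<bullet> b) * f (b *k x))"
      by (simp add: scale_sum_left scaleR_left_scale linear_sum[OF f] linear_scale[OF f])
    then show ?thesis using that by (simp add: euclidean_representation)
  qed
  then have "{x \<in> U. \<forall>c. f (c *k x) = 0} = {x \<in> U. \<forall>b\<in>Basis. f (b *k x) = 0}" by auto
  moreover have "real_vector.subspace U"
    using U(1) by (auto simp: real_vector.subspace_def subspace_add subspace_0 subspace_scaleR)
  ultimately show "infinite_dimensional {x \<in> U. \<forall>c. f (c *k x) = 0}"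
    using infinite_dimensional_kernels[of Basis U "\<lambda>b x. f (b *k x)"] U(2) lin by simp
qed

text \<open>
  Every \<open>u n\<close> is annihilated by the functionals chosen before it and normed by its own functional, so
  the coordinates of a finite combination can be recovered successively, each up to the sum of the
  previous ones. This replaces Mazur's construction of a basic sequence: the bounds \<open>2 ^ n\<close> grow, but
  they are known before the perturbations of the \<open>u n\<close> are chosen.
\<close>

lemma bounded_coordinates:
  assumes U: "subspace U" "infinite_dimensional U"
  obtains u where "\<And>n::nat. u n \<in> U"
    "\<And>a n N. n < N \<Longrightarrow> norm (a n) \<le> 2 ^ n * norm (\<Sum>i<N. a i *k u i)"
proof -
  define Q where "Q V V' \<longleftrightarrow> (\<exists>u f. u \<in> V \<and> linear (f :: 'a \<Rightarrow> real) \<and> (\<forall>x. \<bar>f x\<bar> \<le> norm x) \<and>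
    norm u = 1 \<and> f u = 1 \<and> V' = {x \<in> V. \<forall>c. f (c *k x) = 0})" for V V'
  have "\<exists>V. \<forall>n::nat. (subspace (V n) \<and> infinite_dimensional (V n) \<and> V n \<subseteq> U) \<and> Q (V n) (V (Suc n))"
  proof (rule dependent_nat_choice)
    show "\<exists>V. subspace V \<and> infinite_dimensional V \<and> V \<subseteq> U" using U by blast
    fix V n assume V: "subspace V \<and> infinite_dimensional V \<and> V \<subseteq> U"
    then have "\<not> V \<subseteq> span {}" unfolding infinite_dimensional_def by blast
    then obtain v where v: "v \<in> V" "v \<noteq> 0" by auto
    define u where "u = (1 / norm v) *\<^sub>R v"
    have u: "u \<in> V" "norm u = 1" using V v by (auto simp: u_def intro: subspace_scaleR)
    obtain f where f: "linear f" "\<And>x. \<bar>f x\<bar> \<le> norm x" "f u = norm u" using norming_functional by blast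
    have "Q V {x \<in> V. \<forall>c. f (c *k x) = 0}" unfolding Q_def using u f by auto
    then show "\<exists>V'. (subspace V' \<and> infinite_dimensional V' \<and> V' \<subseteq> U) \<and> Q V V'"
      using infinite_dimensional_annihilated_part[of V f] V f(1) by blast
  qed
  then obtain V where V: "\<And>n::nat. subspace (V n)" "\<And>n. V n \<subseteq> U" "\<And>n. Q (V n) (V (Suc n))" by blast
  have "\<exists>u. \<forall>n. \<exists>f. u n \<in> V n \<and> linear (f :: 'a \<Rightarrow> real) \<and> (\<forall>x. \<bar>f x\<bar> \<le> norm x) \<and>
    norm (u n) = 1 \<and> f (u n) = 1 \<and> V (Suc n) = {x \<in> V n. \<forall>c. f (c *k x) = 0}"
    using V(3) unfolding Q_def by (intro choice) blast
  then obtain u where "\<forall>n. \<exists>f. u n \<in> V n \<and> linear (f :: 'a \<Rightarrow> real) \<and> (\<forall>x. \<bar>f x\<bar> \<le> norm x) \<and>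
    norm (u n) = 1 \<and> f (u n) = 1 \<and> V (Suc n) = {x \<in> V n. \<forall>c. f (c *k x) = 0}" ..
  from choice[OF this] obtain f where uf: "\<And>n. u n \<in> V n" "\<And>n. linear (f n :: 'a \<Rightarrow> real)" "\<And>n x. \<bar>f n x\<bar> \<le> norm x"
    "\<And>n. norm (u n) = 1" "\<And>n. f n (u n) = 1" "\<And>n. V (Suc n) = {x \<in> V n. \<forall>c. f n (c *k x) = 0}"
    by blast
  have dec: "V n \<subseteq> V m" if "m \<le> n" for m n
    using that by (induction n rule: dec_induct) (auto simp: uf(6))
  have zero: "f n (c *k u i) = 0" if "n < i" for n i c
    using dec[of "Suc n" i] that uf(1)[of i] uf(6)[of n] by auto
  have step: "norm (a n) \<le> norm (\<Sum>i<N. a i *k u i) + (\<Sum>i<n. norm (a i))" if "n < N" for a n N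
  proof (cases "a n = 0")
    case True then show ?thesis by (simp add: sum_nonneg)
  next
    case False
    define x where "x = (\<Sum>i<N. a i *k u i)"
    \<comment> \<open>Normalizing the n-th coefficient to 1 lets the merely real-linear
      \<open>f n\<close> detect its full modulus; later terms vanish under \<open>f n\<close>, and
      earlier ones remain as the error.\<close>
    define c where "c = inverse (a n)"
    have split: "{..<N} = {..<n} \<union> {n} \<union> {Suc n..<N}" using that by auto
    have "f n (c *k x) = (\<Sum>i<N. f n ((c * a i) *k u i))"
      by (simp add: x_def scale_sum_right linear_sum[OF uf(2)])
    also have "\<dots> = (\<Sum>i<n. f n ((c * a i) *k u i)) + f n ((c * a n) *k u n)
        + (\<Sum>i=Suc n..<N. f n ((c * a i) *k u i))"
      unfolding split by (subst sum.union_disjoint, auto)+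
    also have "\<dots> = f n (c *k (\<Sum>i<n. a i *k u i)) + 1"
      using False by (simp add: zero uf(5) c_def scale_sum_right linear_sum[OF uf(2)])
    finally have "1 \<le> norm (c *k x) + norm (c *k (\<Sum>i<n. a i *k u i))"
      using uf(3)[of n "c *k x"] uf(3)[of n "c *k (\<Sum>i<n. a i *k u i)"] by linarith
    also have "\<dots> = (norm x + norm (\<Sum>i<n. a i *k u i)) / norm (a n)"
      by (simp add: norm_scale c_def norm_inverse divide_inverse algebra_simps)
    finally have "norm (a n) \<le> norm x + norm (\<Sum>i<n. a i *k u i)"
      using False by (simp add: le_divide_eq)
    also have "norm (\<Sum>i<n. a i *k u i) \<le> (\<Sum>i<n. norm (a i))"
      by (rule order_trans[OF norm_sum]) (simp add: norm_scale uf(4))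
    finally show ?thesis by (simp add: x_def)
  qed
  have "norm (a n) \<le> 2 ^ n * norm (\<Sum>i<N. a i *k u i)" if "n < N" for a n N
    using that
  proof (induction n rule: less_induct)
    case (less n)
    have "(\<Sum>i<n. norm (a i)) \<le> (\<Sum>i<n. 2 ^ i * norm (\<Sum>i<N. a i *k u i))"
      using less by (intro sum_mono) auto
    also have "\<dots> = (2 ^ n - 1) * norm (\<Sum>i<N. a i *k u i)"
      by (simp add: sum_distrib_right[symmetric] sum_gp_strict)
    finally show ?case using step[OF less.prems, of a] by (simp add: algebra_simps)
  qed
  then show ?thesis using that[of u] uf(1) V(2) by blast
qed

text \<open>The coordinate bounds \<open>2 ^ i\<close> times the errors
  \<open>\<eta> / 4 ^ Suc i\<close> form a geometric sequence of ratio 1/2 whose sum is at most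
  \<open>\<eta>\<close>.\<close>

lemma perturbation_bound:
  assumes u: "\<And>a n N. n < N \<Longrightarrow> norm (a n) \<le> 2 ^ n * norm (\<Sum>i<N. a i *k u i)"
    and w: "\<And>n::nat. norm (u n - w n) \<le> \<eta> / 4 ^ Suc n"
  shows "norm ((\<Sum>i<N. a i *k u i) - (\<Sum>i<N. a i *k w i)) \<le> \<eta> * norm (\<Sum>i<N. a i *k u i)"
proof -
  define x where "x = (\<Sum>i<N. a i *k u i)"
  have \<eta>: "\<eta> \<ge> 0" using order_trans[OF norm_ge_zero w[of 0]] by simp
  have "x - (\<Sum>i<N. a i *k w i) = (\<Sum>i<N. a i *k (u i - w i))"
    by (simp add: x_def sum_subtractf scale_right_diff_distrib)
  also have "norm \<dots> \<le> (\<Sum>i<N. norm (a i) * norm (u i - w i))"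
    by (rule order_trans[OF norm_sum]) (simp add: norm_scale)
  also have "\<dots> \<le> (\<Sum>i<N. (2 ^ i * norm x) * (\<eta> / 4 ^ Suc i))"
    using u[of _ N a] w by (intro sum_mono mult_mono) (auto simp: x_def)
  also have "\<dots> = (\<Sum>i<N. (\<eta> * norm x / 4) * (1/2) ^ i)"
    by (intro sum.cong) (auto simp: power_divide field_simps simp flip: power_mult_distrib)
  also have "\<dots> = (\<eta> * norm x / 4) * (\<Sum>i<N. (1/2) ^ i)" by (rule sum_distrib_left[symmetric])
  also have "(\<Sum>i<N. (1/2) ^ i) = 2 - 2 * (1/2 :: real) ^ N" by (simp add: sum_gp_strict)
  also have "(\<eta> * norm x / 4) * (2 - 2 * (1/2) ^ N) \<le> (\<eta> * norm x / 4) * 2" using \<eta> by (intro mult_left_mono) auto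
  also have "\<dots> \<le> \<eta> * norm x" using \<eta> by simp
  finally show ?thesis by (simp add: x_def)
qed

text \<open>A linear relation expressing \<open>w n\<close> through its predecessors has coefficient
  -1 at \<open>n\<close>. By \<open>perturbation_bound\<close> and \<open>\<eta> < 1\<close> the
  same combination of the \<open>u i\<close> vanishes, which contradicts the coordinate bound at
  \<open>n\<close>.\<close>

lemma infinite_dimensional_perturbation:
  assumes u: "\<And>a n N. n < N \<Longrightarrow> norm (a n) \<le> 2 ^ n * norm (\<Sum>i<N. a i *k u i)"
    and w: "\<And>n::nat. norm (u n - w n) \<le> \<eta> / 4 ^ Suc n" and \<eta>: "\<eta> < 1"
  shows "infinite_dimensional (range w)"
proof (rule infinite_dimensional_free_sequence)
  fix n
  show "w n \<notin> span (w ` {..<n})"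
  proof
    assume "w n \<in> span (w ` {..<n})"
    then obtain c where c: "w n = (\<Sum>i<n. c i *k w i)" by (rule span_initial_segment_sum)
    define a where "a = c(n := -1)"
    have "(\<Sum>i<Suc n. a i *k w i) = 0" using c by (simp add: a_def)
    then have "norm (\<Sum>i<Suc n. a i *k u i) \<le> \<eta> * norm (\<Sum>i<Suc n. a i *k u i)"
      using perturbation_bound[where N = "Suc n" and a = a, OF u w] by simp
    then have "norm (\<Sum>i<Suc n. a i *k u i) = 0"
      using \<eta> by (smt (verit) mult_less_cancel_right2 norm_ge_zero)
    then show False using u[of n "Suc n" a] by (simp add: a_def)
  qed
qed

end

subsection \<open>Acceptance and rejection\<close>

text \<open>Inverses serve the codimension argument \<open>big_inter_finite_codim\<close>; because
  \<open>inverse 0 = 0\<close>, the axiom can range over all of \<open>D\<close>.\<close>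

locale countable_dense_subfield = normed_space_over scale
  for scale :: "'k::{real_normed_field,euclidean_space} \<Rightarrow> 'a::real_normed_vector \<Rightarrow> 'a"
    (infixr \<open>*k\<close> 75) +
  fixes D :: "'k set"
  assumes countable_D: "countable D"
    and dense_D: "closure D = UNIV"
    and one_D: "1 \<in> D"
    and add_D: "x \<in> D \<Longrightarrow> y \<in> D \<Longrightarrow> x + y \<in> D"
    and mult_D: "x \<in> D \<Longrightarrow> y \<in> D \<Longrightarrow> x * y \<in> D"
    and minus_D: "x \<in> D \<Longrightarrow> - x \<in> D"
    and inverse_D: "x \<in> D \<Longrightarrow> inverse x \<in> D"
begin

lemma zero_D: "0 \<in> D"
  using add_D[OF one_D minus_D[OF one_D]] by simp

text \<open>
  The Ramsey argument is run with linear spaces over \<open>D\<close>, since then a countable vector space has only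
  countably many finite subsets to decide. Dimension is still counted over the full scalar field.
\<close>

definition dsub :: "'a set \<Rightarrow> bool" where
  "dsub S \<longleftrightarrow> 0 \<in> S \<and> (\<forall>x\<in>S. \<forall>y\<in>S. x + y \<in> S) \<and> (\<forall>d\<in>D. \<forall>x\<in>S. d *k x \<in> S)"

definition dspan :: "'a set \<Rightarrow> 'a set" where
  "dspan S = dsub hull S"

lemma dsubD:
  assumes "dsub S"
  shows "0 \<in> S" "x \<in> S \<Longrightarrow> y \<in> S \<Longrightarrow> x + y \<in> S" "d \<in> D \<Longrightarrow> x \<in> S \<Longrightarrow> d *k x \<in> S"
    "x \<in> S \<Longrightarrow> - x \<in> S" "x \<in> S \<Longrightarrow> y \<in> S \<Longrightarrow> x - y \<in> S"
proof -
  show *: "0 \<in> S" "\<And>x y. x \<in> S \<Longrightarrow> y \<in> S \<Longrightarrow> x + y \<in> S" "\<And>x d. d \<in> D \<Longrightarrow> x \<in> S \<Longrightarrow> d *k x \<in> S"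
    using assms by (auto simp: dsub_def)
  show neg: "- x \<in> S" if "x \<in> S" for x using *(3)[OF minus_D[OF one_D] that] by simp
  show "x \<in> S \<Longrightarrow> y \<in> S \<Longrightarrow> x - y \<in> S" using *(2)[of x "-y"] neg[of y] by simp
qed

lemma dsub_inter: "dsub S \<Longrightarrow> dsub T \<Longrightarrow> dsub (S \<inter> T)"
  by (auto simp: dsub_def)

lemma dsub_dspan [simp]: "dsub (dspan S)"
  unfolding dspan_def by (rule hull_in) (auto simp: dsub_def)

lemma dspan_superset: "S \<subseteq> dspan S"
  unfolding dspan_def by (rule hull_subset)

lemma dspan_minimal: "S \<subseteq> T \<Longrightarrow> dsub T \<Longrightarrow> dspan S \<subseteq> T"
  unfolding dspan_def by (rule hull_minimal)

lemma dspan_mono: "S \<subseteq> T \<Longrightarrow> dspan S \<subseteq> dspan T"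
  unfolding dspan_def by (rule hull_mono)

lemma dspan_eq: "dsub S \<Longrightarrow> dspan S = S"
  using dspan_minimal[of S S] dspan_superset[of S] by auto

lemma dspan_range_sum:
  assumes "x \<in> dspan (range w)"
  obtains a N where "x = (\<Sum>i<N::nat. a i *k w i)" "\<And>i. a i \<in> D"
proof -
  define S where "S = {x. \<exists>a N. x = (\<Sum>i<N::nat. a i *k w i) \<and> (\<forall>i. a i \<in> D)}"
  have "0 \<in> S" unfolding S_def using zero_D by (auto intro!: exI[of _ 0] exI[of _ "\<lambda>_. 0"])
  moreover have "x + y \<in> S" if "x \<in> S" "y \<in> S" for x y
  proof -
    from that obtain a N b M where "x = (\<Sum>i<N::nat. a i *k w i)" "y = (\<Sum>i<M::nat. b i *k w i)"
      and ab: "\<And>i. a i \<in> D" "\<And>i. b i \<in> D"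
      by (auto simp: S_def)
    moreover define c where "c i = (if i < N then a i else 0) + (if i < M then b i else 0)" for i
    ultimately have "x + y = (\<Sum>i<max N M. c i *k w i)" by (simp only: sum_add_pad c_def)
    moreover have "c i \<in> D" for i using ab zero_D add_D by (simp add: c_def)
    ultimately show ?thesis unfolding S_def by blast
  qed
  moreover have "d *k x \<in> S" if "x \<in> S" "d \<in> D" for d x
  proof -
    from that obtain a N where "x = (\<Sum>i<N::nat. a i *k w i)" and a: "\<And>i. a i \<in> D"
      by (auto simp: S_def)
    moreover define c where "c i = d * a i" for i
    ultimately have "d *k x = (\<Sum>i<N. c i *k w i)" by (simp add: scale_sum_right)
    moreover have "c i \<in> D" for i using a mult_D that by (simp add: c_def)
    ultimately show ?thesis unfolding S_def by blast
  qed
  ultimately have S: "dsub S" by (auto simp: dsub_def)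
  have "w n \<in> S" for n
  proof -
    define c where "c i = (if i = n then 1 else 0 :: 'k)" for i
    have "w n = (\<Sum>i<Suc n. c i *k w i)" by (simp add: c_def)
    moreover have "c i \<in> D" for i using zero_D one_D by (simp add: c_def)
    ultimately show ?thesis unfolding S_def by blast
  qed
  then have "dspan (range w) \<subseteq> S" using S by (intro dspan_minimal) auto
  with assms that show ?thesis by (auto simp: S_def)
qed

lemma sum_in_dsub:
  assumes "dsub S" "\<And>i. i \<in> I \<Longrightarrow> a i \<in> D" "\<And>i. i \<in> I \<Longrightarrow> w i \<in> S"
  shows "(\<Sum>i\<in>I. a i *k w i) \<in> S"
  using assms(2,3) by (induction I rule: infinite_finite_induct) (auto simp: dsubD[OF assms(1)])

section \<open>Finite codimension, almost containment and the diagonal argument\<close>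

abbreviation big :: "'a set \<Rightarrow> bool" where
  "big S \<equiv> dsub S \<and> infinite_dimensional S"

lemma big_dspan: "infinite_dimensional S \<Longrightarrow> big (dspan S)"
  using infinite_dimensional_mono[OF _ dspan_superset] by simp

text \<open>If some \<open>t \<in> U\<close> has a nonzero coefficient at \<open>y\<close>,
  subtracting a multiple of \<open>t\<close> from any vector of \<open>U\<close> removes its
  \<open>y\<close> part. The quotient of the coefficients lies in \<open>D\<close>, so the
  difference stays in \<open>U\<close> and in \<open>S\<close>.\<close>

lemma big_inter_finite_codim:
  assumes U: "big U" and S: "dsub S" and "U \<subseteq> {d *k y + s |d s. d \<in> D \<and> s \<in> S}"
  shows "big (U \<inter> S)"
proof -
  have "\<exists>t. U \<subseteq> span ((U \<inter> S) \<union> {t})"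
  proof (cases "U \<subseteq> S")
    case True
    then show ?thesis using span_superset[of "(U \<inter> S) \<union> {0}"] by (intro exI[of _ 0]) auto
  next
    case False
    then obtain t where t: "t \<in> U" "t \<notin> S" by auto
    then obtain d s where ds: "t = d *k y + s" "d \<in> D" "s \<in> S" using assms(3) by blast
    then have d: "d \<noteq> 0" using t(2) by auto
    have "u \<in> span ((U \<inter> S) \<union> {t})" if u: "u \<in> U" for u
    proof -
      obtain d' s' where ds': "u = d' *k y + s'" "d' \<in> D" "s' \<in> S" using assms(3) u by blast
      define r where "r = d' * inverse d"
      have r: "r \<in> D" using ds ds' mult_D inverse_D by (auto simp: r_def)
      have "u - r *k t = s' - r *k s" using d by (simp add: ds ds' r_def scale_right_distrib)
      then have "u - r *k t \<in> S" using r ds(3) ds'(3) dsubD[OF S] by simp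
      moreover have "u - r *k t \<in> U" using r u t(1) U dsubD(3,5)[of U] by blast
      ultimately have "u - r *k t \<in> U \<inter> S" by simp
      then have "(u - r *k t) + r *k t \<in> span ((U \<inter> S) \<union> {t})"
        by (intro span_add span_scale) (auto intro: span_base)
      then show ?thesis by simp
    qed
    then show ?thesis by blast
  qed
  then have "infinite_dimensional (U \<inter> S)"
    using infinite_dimensional_finite_codim[of U] U by blast
  then show ?thesis using dsub_inter U S by blast
qed

text \<open>A weakening of containment up to finite dimension, phrased through subspaces because
  acceptance quantifies over them.\<close>

definition almost_contained :: "'a set \<Rightarrow> 'a set \<Rightarrow> bool" where
  "almost_contained Z' Z \<longleftrightarrow> (\<forall>U. big U \<longrightarrow> U \<subseteq> Z' \<longrightarrow> big (U \<inter> Z))"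

text \<open>\<open>Z'\<close> is generated by vectors \<open>z n \<in> Z n\<close>. The tail
  generated from index \<open>m\<close> on lies in \<open>Z m\<close>, and \<open>Z'\<close> exceeds
  it by only finitely many generators.\<close>

lemma diagonal_subspace:
  assumes Z: "\<And>n::nat. big (Z n)" and dec: "\<And>n. Z (Suc n) \<subseteq> Z n"
  obtains Z' where "big Z'" "Z' \<subseteq> Z 0" "\<And>n. almost_contained Z' (Z n)"
proof -
  have mono: "Z n \<subseteq> Z m" if "m \<le> n" for m n
    using that by (induction n rule: dec_induct) (use dec in blast)+
  obtain z where z: "\<And>n::nat. z n \<in> Z n" "\<And>n. z n \<notin> span (z ` {..<n})"
    using free_sequence_exists[of Z] Z by blast
  define T where "T m = dspan (z ` {m..})" for m
  have TZ: "T m \<subseteq> Z m" for m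
    unfolding T_def using z(1) mono Z by (intro dspan_minimal) blast+
  \<comment> \<open>One generator is dropped at a time, so each step is an instance of
    \<open>big_inter_finite_codim\<close>.\<close>
  have "big (U \<inter> T m)" if U: "big U" "U \<subseteq> T 0" for U m
  proof (induction m)
    case 0 then show ?case using U by (simp add: Int_absorb2)
  next
    case (Suc m)
    let ?R = "{d *k z m + s |d s. d \<in> D \<and> s \<in> T (Suc m)}"
    have T: "dsub (T (Suc m))" by (simp add: T_def)
    have "dsub ?R"
      unfolding dsub_def
    proof (intro conjI ballI)
      show "0 \<in> ?R" using zero_D dsubD(1)[OF T] by (auto intro!: exI[of _ 0])
    next
      fix x y assume "x \<in> ?R" "y \<in> ?R"
      then obtain d s d' s' where "x = d *k z m + s" "y = d' *k z m + s'"
        "d \<in> D" "d' \<in> D" "s \<in> T (Suc m)" "s' \<in> T (Suc m)" by blast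
      moreover from this have "x + y = (d + d') *k z m + (s + s')" by (simp add: scale_left_distrib)
      ultimately show "x + y \<in> ?R" using add_D dsubD(2)[OF T] by blast
    next
      fix c x assume "c \<in> D" "x \<in> ?R"
      then obtain d s where "x = d *k z m + s" "d \<in> D" "s \<in> T (Suc m)" by blast
      moreover from this have "c *k x = (c * d) *k z m + c *k s" by (simp add: scale_right_distrib)
      ultimately show "c *k x \<in> ?R" using mult_D dsubD(3)[OF T] \<open>c \<in> D\<close> by blast
    qed
    moreover have "z k \<in> ?R" if "k \<ge> m" for k
    proof (cases "k = m")
      case True
      then have "z k = 1 *k z m + 0" by simp
      then show ?thesis using one_D dsubD(1)[OF T] by blast
    next
      case False
      then have "z k \<in> T (Suc m)" using that dspan_superset[of "z ` {Suc m..}"] by (auto simp: T_def)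
      moreover have "z k = 0 *k z m + z k" by simp
      ultimately show ?thesis using zero_D by blast
    qed
    ultimately have "T m \<subseteq> ?R" unfolding T_def[of m] by (intro dspan_minimal) auto
    then have "big ((U \<inter> T m) \<inter> T (Suc m))"
      using Suc T by (intro big_inter_finite_codim[of "U \<inter> T m" "T (Suc m)" "z m"]) blast+
    moreover have "T (Suc m) \<subseteq> T m" unfolding T_def by (intro dspan_mono image_mono) auto
    then have "(U \<inter> T m) \<inter> T (Suc m) = U \<inter> T (Suc m)" by auto
    ultimately show ?case by simp
  qed
  then have "big (U \<inter> Z m)" if "big U" "U \<subseteq> T 0" for U m
    using that TZ[of m] infinite_dimensional_mono[of "U \<inter> T m" "U \<inter> Z m"] dsub_inter Z by blast
  then have "almost_contained (T 0) (Z m)" for m by (auto simp: almost_contained_def)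
  moreover have "big (T 0)"
    using big_dspan[OF infinite_dimensional_free_sequence[OF z(2)]] by (simp add: T_def atLeast_0)
  ultimately show ?thesis using that TZ[of 0] by blast
qed

text \<open>At step \<open>n\<close> the current subspace shrinks to one with \<open>P (i n)\<close>
  whenever such a subspace exists. Both outcomes survive in the diagonal subspace: \<open>P\<close>
  by its invariance, and failure because a counterexample inside \<open>Z'\<close> could be cut down
  to one inside \<open>Z n\<close>.\<close>

lemma stabilization:
  fixes P :: "'i \<Rightarrow> 'a set \<Rightarrow> bool"
  assumes I: "countable I" and Z0: "big Z0"
    and P: "\<And>i Z Z'. i \<in> I \<Longrightarrow> big Z \<Longrightarrow> P i Z \<Longrightarrow> almost_contained Z' Z \<Longrightarrow> P i Z'"
  obtains Z where "big Z" "Z \<subseteq> Z0" "\<And>i. i \<in> I \<Longrightarrow> P i Z \<or> (\<forall>Z'. big Z' \<longrightarrow> Z' \<subseteq> Z \<longrightarrow> \<not> P i Z')"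
proof (cases "I = {}")
  case True then show ?thesis using that[of Z0] Z0 by auto
next
  case False
  define i where "i = from_nat_into I"
  have i: "i n \<in> I" for n using False by (simp add: i_def from_nat_into)
  define R where "R n Z Z' \<longleftrightarrow> Z' \<subseteq> Z \<and> (P (i n) Z' \<or> (\<forall>Y. big Y \<longrightarrow> Y \<subseteq> Z \<longrightarrow> \<not> P (i n) Y))" for n Z Z'
  \<comment> \<open>The clause at \<open>n = 0\<close> fixes the start of the recursion at
    \<open>Z0\<close>.\<close>
  have "\<exists>Z. \<forall>n::nat. (big (Z n) \<and> (n = 0 \<longrightarrow> Z n = Z0)) \<and> R n (Z n) (Z (Suc n))"
  proof (rule dependent_nat_choice)
    show "\<exists>x. big x \<and> ((0::nat) = 0 \<longrightarrow> x = Z0)" using Z0 by blast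
    fix Z and n :: nat assume Z: "big Z \<and> (n = 0 \<longrightarrow> Z = Z0)"
    show "\<exists>y. (big y \<and> (Suc n = 0 \<longrightarrow> y = Z0)) \<and> R n Z y"
    proof (cases "\<exists>Y. big Y \<and> Y \<subseteq> Z \<and> P (i n) Y")
      case True then show ?thesis by (auto simp: R_def)
    next
      case False then show ?thesis using Z by (intro exI[of _ Z]) (auto simp: R_def)
    qed
  qed
  then obtain Z where Z: "\<And>n::nat. big (Z n)" "Z 0 = Z0" "\<And>n. R n (Z n) (Z (Suc n))" by blast
  obtain Z' where Z': "big Z'" "Z' \<subseteq> Z0" "\<And>n. almost_contained Z' (Z n)"
    using diagonal_subspace[of Z] Z unfolding R_def by metis
  have "P (i n) Z' \<or> (\<forall>Y. big Y \<longrightarrow> Y \<subseteq> Z' \<longrightarrow> \<not> P (i n) Y)" for n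
  proof (rule disjCI)
    assume neg: "\<not> (\<forall>Y. big Y \<longrightarrow> Y \<subseteq> Z' \<longrightarrow> \<not> P (i n) Y)"
    then obtain Y where Y: "big Y" "Y \<subseteq> Z'" "P (i n) Y" by blast
    \<comment> \<open>The cut \<open>Y \<inter> Z n\<close> was a candidate at step
      \<open>n\<close>, so \<open>P (i n)\<close> was achieved at \<open>Z (Suc n)\<close>.\<close>
    have "big (Y \<inter> Z n)" using Z'(3) Y by (auto simp: almost_contained_def)
    moreover have "almost_contained (Y \<inter> Z n) Y"
      by (auto simp: almost_contained_def Int_absorb2 le_infI1)
    then have "P (i n) (Y \<inter> Z n)" using P[OF i Y(1,3)] by blast
    ultimately have "P (i n) (Z (Suc n))" using Z(3)[of n] unfolding R_def by blast
    then show "P (i n) Z'" using P[OF i Z(1)] Z'(3) by blast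
  qed
  moreover have "\<exists>n. i n = j" if "j \<in> I" for j
    using from_nat_into_surj[OF I that] by (simp add: i_def)
  ultimately show ?thesis using that Z' by metis
qed

text \<open>
  Adding to \<open>A\<close> a vector of \<open>U\<close> does not change \<open>dspan (A \<union> U)\<close>; this makes rejection extendable
  by one more vector.
\<close>

definition accepts :: "real \<Rightarrow> 'a set \<Rightarrow> 'a set \<Rightarrow> 'a set \<Rightarrow> bool" where
  "accepts \<epsilon> A B Z \<longleftrightarrow> (\<forall>U V. big U \<longrightarrow> U \<subseteq> Z \<longrightarrow> big V \<longrightarrow> V \<subseteq> Z \<longrightarrow>
     (\<exists>x\<in>dspan (A \<union> U). \<exists>y\<in>dspan (B \<union> V). norm (x - y) < \<epsilon> * norm (x + y)))"

definition rejects :: "real \<Rightarrow> 'a set \<Rightarrow> 'a set \<Rightarrow> 'a set \<Rightarrow> bool" where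
  "rejects \<epsilon> A B Z \<longleftrightarrow> (\<forall>Z'. big Z' \<longrightarrow> Z' \<subseteq> Z \<longrightarrow> \<not> accepts \<epsilon> A B Z')"

lemma accepts_commute: "accepts \<epsilon> A B Z \<longleftrightarrow> accepts \<epsilon> B A Z"
  unfolding accepts_def by (metis add.commute norm_minus_commute)

lemma rejects_commute: "rejects \<epsilon> A B Z \<longleftrightarrow> rejects \<epsilon> B A Z"
  unfolding rejects_def by (simp add: accepts_commute)

text \<open>Cutting \<open>U\<close> and \<open>V\<close> down to \<open>Z\<close> only shrinks the
  spans, so witnesses found there remain valid. This is the invariance that
  \<open>stabilization\<close> asks for.\<close>

lemma accepts_almost_contained:
  assumes "accepts \<epsilon> A B Z" "big Z" "almost_contained Z' Z"
  shows "accepts \<epsilon> A B Z'"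
  unfolding accepts_def
proof (intro allI impI)
  fix U V assume UV: "big U" "U \<subseteq> Z'" "big V" "V \<subseteq> Z'"
  then have "big (U \<inter> Z)" "big (V \<inter> Z)" using assms(3) by (auto simp: almost_contained_def)
  then obtain x y where "x \<in> dspan (A \<union> (U \<inter> Z))" "y \<in> dspan (B \<union> (V \<inter> Z))"
    "norm (x - y) < \<epsilon> * norm (x + y)"
    using assms(1) unfolding accepts_def by (meson inf_le2)
  moreover have "dspan (A \<union> (U \<inter> Z)) \<subseteq> dspan (A \<union> U)" "dspan (B \<union> (V \<inter> Z)) \<subseteq> dspan (B \<union> V)"
    by (rule dspan_mono, blast)+
  ultimately show "\<exists>x\<in>dspan (A \<union> U). \<exists>y\<in>dspan (B \<union> V). norm (x - y) < \<epsilon> * norm (x + y)"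
    by blast
qed

text \<open>A violating pair \<open>x\<close>, \<open>y\<close> would serve as witness for all
  \<open>U\<close> and \<open>V\<close>, so \<open>Z\<close> itself would accept. Rejection thereby
  becomes a norm inequality between fixed vectors.\<close>

lemma rejects_norm_ge:
  assumes "rejects \<epsilon> A B Z" "big Z" "x \<in> dspan A" "y \<in> dspan B"
  shows "\<epsilon> * norm (x + y) \<le> norm (x - y)"
proof (rule ccontr)
  assume "\<not> ?thesis"
  then have "norm (x - y) < \<epsilon> * norm (x + y)" by simp
  moreover have "x \<in> dspan (A \<union> U)" "y \<in> dspan (B \<union> U)" for U
    using assms(3,4) dspan_mono[of A "A \<union> U"] dspan_mono[of B "B \<union> U"] by auto
  ultimately have "accepts \<epsilon> A B Z" unfolding accepts_def by blast
  then show False using assms(1,2) unfolding rejects_def by blast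
qed

end

section \<open>Extending rejected pairs in a decided subspace\<close>

locale decided_subspace = countable_dense_subfield scale D
  for scale :: "'k::{real_normed_field,euclidean_space} \<Rightarrow> 'a::real_normed_vector \<Rightarrow> 'a"
    (infixr \<open>*k\<close> 75) and D +
  fixes \<epsilon> :: real and Z :: "'a set"
  assumes big_Z: "big Z"
    and decided: "finite A \<Longrightarrow> finite B \<Longrightarrow> A \<union> B \<subseteq> Z \<Longrightarrow> accepts \<epsilon> A B Z \<or> rejects \<epsilon> A B Z"
begin

text \<open>Otherwise every big \<open>U\<close> inside \<open>Z'\<close> contains some
  \<open>z\<close> for which the enlarged pair is not rejected, hence accepted. As \<open>z\<close>
  already lies in \<open>U\<close>, the witnesses serve the original pair, and \<open>Z'\<close>
  accepts \<open>(A, B)\<close>.\<close>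

lemma rejects_insert:
  assumes rej: "rejects \<epsilon> A B Z" and AB: "finite A" "finite B" "A \<union> B \<subseteq> Z"
    and Z': "big Z'" "Z' \<subseteq> Z"
  obtains Z'' where "big Z''" "Z'' \<subseteq> Z'" "\<And>z. z \<in> Z'' \<Longrightarrow> rejects \<epsilon> (insert z A) B Z"
proof -
  have "\<exists>Z''. big Z'' \<and> Z'' \<subseteq> Z' \<and> (\<forall>z\<in>Z''. rejects \<epsilon> (insert z A) B Z)"
  proof (rule ccontr)
    assume neg: "\<not> ?thesis"
    have "accepts \<epsilon> A B Z'"
      unfolding accepts_def
    proof (intro allI impI)
      fix U V assume UV: "big U" "U \<subseteq> Z'" "big V" "V \<subseteq> Z'"
      then obtain z where z: "z \<in> U" "\<not> rejects \<epsilon> (insert z A) B Z" using neg by blast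
      then have "accepts \<epsilon> (insert z A) B Z" using decided[of "insert z A" B] AB UV Z' by blast
      then obtain x y where "x \<in> dspan (insert z A \<union> U)" "y \<in> dspan (B \<union> V)"
        "norm (x - y) < \<epsilon> * norm (x + y)"
        using UV Z' unfolding accepts_def by (meson order_trans)
      moreover have "insert z A \<union> U = A \<union> U" using z by auto
      ultimately show "\<exists>x\<in>dspan (A \<union> U). \<exists>y\<in>dspan (B \<union> V). norm (x - y) < \<epsilon> * norm (x + y)"
        by auto
    qed
    then show False using rej Z' by (auto simp: rejects_def)
  qed
  then show ?thesis using that by blast
qed

text \<open>Finitely many successive shrinkings, two per pair; the extension of the second component
  follows from that of the first by symmetry.\<close>

lemma rejects_insert_simultaneous:
  assumes "finite \<P>" "\<And>A B. (A, B) \<in> \<P> \<Longrightarrow> rejects \<epsilon> A B Z \<and> finite A \<and> finite B \<and> A \<union> B \<subseteq> Z"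
  obtains Z' where "big Z'" "Z' \<subseteq> Z"
    "\<And>A B z. (A, B) \<in> \<P> \<Longrightarrow> z \<in> Z' \<Longrightarrow> rejects \<epsilon> (insert z A) B Z \<and> rejects \<epsilon> A (insert z B) Z"
proof -
  have "\<exists>Z'. big Z' \<and> Z' \<subseteq> Z \<and> (\<forall>(A, B)\<in>\<P>. \<forall>z\<in>Z'.
    rejects \<epsilon> (insert z A) B Z \<and> rejects \<epsilon> A (insert z B) Z)"
    using assms
  proof (induction \<P>)
    case empty then show ?case using big_Z by auto
  next
    case (insert p \<P>)
    obtain A B where p: "p = (A, B)" by force
    have AB: "rejects \<epsilon> A B Z" "finite A" "finite B" "A \<union> B \<subseteq> Z" using insert.prems p by auto
    have "\<And>A B. (A, B) \<in> \<P> \<Longrightarrow> rejects \<epsilon> A B Z \<and> finite A \<and> finite B \<and> A \<union> B \<subseteq> Z"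
      using insert.prems by blast
    from insert.IH[OF this] obtain Z1 where Z1: "big Z1" "Z1 \<subseteq> Z"
      "\<forall>(A, B)\<in>\<P>. \<forall>z\<in>Z1. rejects \<epsilon> (insert z A) B Z \<and> rejects \<epsilon> A (insert z B) Z" by blast
    obtain Z2 where Z2: "big Z2" "Z2 \<subseteq> Z1" "\<And>z. z \<in> Z2 \<Longrightarrow> rejects \<epsilon> (insert z A) B Z"
      using rejects_insert[OF AB Z1(1,2)] by blast
    have AB': "rejects \<epsilon> B A Z" "B \<union> A \<subseteq> Z" using AB rejects_commute by blast+
    obtain Z3 where Z3: "big Z3" "Z3 \<subseteq> Z2" "\<And>z. z \<in> Z3 \<Longrightarrow> rejects \<epsilon> (insert z B) A Z"
      using rejects_insert[OF AB'(1) AB(3,2) AB'(2) Z2(1)] Z2(2) Z1(2) by blast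
    show ?case
    proof (intro exI conjI)
      show "dsub Z3" "infinite_dimensional Z3" using Z3(1) by auto
      show "Z3 \<subseteq> Z" using Z1 Z2 Z3 by blast
      show "\<forall>(A, B)\<in>insert p \<P>. \<forall>z\<in>Z3. rejects \<epsilon> (insert z A) B Z \<and> rejects \<epsilon> A (insert z B) Z"
        using Z1(3) Z2(2,3) Z3(2,3) rejects_commute p by fast
    qed
  qed
  then obtain Z' where Z': "big Z'" "Z' \<subseteq> Z" "\<forall>(A, B)\<in>\<P>. \<forall>z\<in>Z'.
    rejects \<epsilon> (insert z A) B Z \<and> rejects \<epsilon> A (insert z B) Z" by blast
  show ?thesis by (rule that[OF Z'(1,2)]) (use Z'(3) in blast)
qed

text \<open>The next vector has to work for all \<open>2 ^ n\<close> splittings at once and on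
  either side, so it comes from the simultaneous extension; infinite dimension leaves room to choose
  it outside the span of the earlier ones.\<close>

lemma all_splittings_rejected:
  assumes "rejects \<epsilon> {} {} Z"
  obtains e where "\<And>n::nat. e n \<in> Z" "\<And>n. e n \<notin> span (e ` {..<n})"
    "\<And>n I. I \<subseteq> {..<n} \<Longrightarrow> rejects \<epsilon> (e ` I) (e ` ({..<n} - I)) Z"
proof -
  define admissible where "admissible n e \<longleftrightarrow> (\<forall>i<n. e i \<in> Z \<and> e i \<notin> span (e ` {..<i})) \<and>
    (\<forall>I\<subseteq>{..<n}. rejects \<epsilon> (e ` I) (e ` ({..<n} - I)) Z)" for n and e :: "nat \<Rightarrow> 'a"
  have cong: "admissible n e = admissible n e'" if "\<And>i. i < n \<Longrightarrow> e i = e' i" for n e e'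
  proof -
    have *: "e ` I = e' ` I" if "I \<subseteq> {..<n}" for I
      using that \<open>\<And>i. i < n \<Longrightarrow> e i = e' i\<close> by (intro image_cong) auto
    then have "e ` {..<i} = e' ` {..<i}" if "i < n" for i using that by auto
    then show ?thesis unfolding admissible_def using that * by (simp cong: conj_cong all_cong)
  qed
  \<comment> \<open>The trivial update \<open>e(n := e n)\<close> fits the recursion principle,
    which treats the value at \<open>n\<close> apart from its predecessors; \<open>cong\<close>
    shows that values beyond \<open>n\<close> do not matter.\<close>
  have "\<exists>e. \<forall>n. admissible (Suc n) (e(n := e n))"
  proof (rule dependent_wellorder_choice[of "\<lambda>e n r. admissible (Suc n) (e(n := r))"])
    fix r and f g :: "nat \<Rightarrow> 'a" and n assume "\<And>y. y < n \<Longrightarrow> f y = g y"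
    then show "admissible (Suc n) (f(n := r)) = admissible (Suc n) (g(n := r))"
      by (intro cong) (auto simp: less_Suc_eq)
  next
    fix n and e :: "nat \<Rightarrow> 'a" assume IH: "\<And>m. m < n \<Longrightarrow> admissible (Suc m) (e(m := e m))"
    have admissible: "admissible n e"
    proof (cases n)
      case 0 then show ?thesis using assms by (simp add: admissible_def)
    next
      case (Suc m) then show ?thesis using IH[of m] by simp
    qed
    define \<P> where "\<P> = (\<lambda>I. (e ` I, e ` ({..<n} - I))) ` Pow {..<n}"
    have "finite \<P>" by (simp add: \<P>_def)
    moreover have *: "rejects \<epsilon> A B Z \<and> finite A \<and> finite B \<and> A \<union> B \<subseteq> Z" if "(A, B) \<in> \<P>" for A B
      using that admissible finite_subset[of _ "{..<n}"] unfolding \<P>_def admissible_def by auto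
    ultimately obtain Z' where Z': "big Z'" "Z' \<subseteq> Z"
      "\<And>A B z. (A, B) \<in> \<P> \<Longrightarrow> z \<in> Z' \<Longrightarrow> rejects \<epsilon> (insert z A) B Z \<and> rejects \<epsilon> A (insert z B) Z"
      using rejects_insert_simultaneous[OF _ *] by metis
    then obtain z where z: "z \<in> Z'" "z \<notin> span (e ` {..<n})"
      unfolding infinite_dimensional_def by blast
    define e' where "e' = e(n := z)"
    have e': "admissible n e'" using admissible cong[of n e e'] by (simp add: e'_def)
    have im: "e' ` I = e ` I" if "I \<subseteq> {..<n}" for I using that by (intro image_cong) (auto simp: e'_def)
    have "rejects \<epsilon> (e' ` I) (e' ` ({..<Suc n} - I)) Z" if I: "I \<subseteq> {..<Suc n}" for I
    \<comment> \<open>A splitting of the longer segment arises from one of the shorter by adding the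
      new vector to the side that contains the index \<open>n\<close>.\<close>
    proof (cases "n \<in> I")
      case True
      define J where "J = I - {n}"
      have J: "J \<subseteq> {..<n}" "I = insert n J" "{..<Suc n} - I = {..<n} - J"
        using I True by (auto simp: J_def less_Suc_eq)
      then have "e' ` I = insert z (e ` J)" "e' ` ({..<Suc n} - I) = e ` ({..<n} - J)"
        using im[of J] im[of "{..<n} - J"] by (auto simp: e'_def)
      then show ?thesis using Z'(3)[of "e ` J" "e ` ({..<n} - J)" z] J(1) z(1) by (simp add: \<P>_def)
    next
      case False
      have J: "I \<subseteq> {..<n}" "{..<Suc n} - I = insert n ({..<n} - I)" using I False
        by (auto simp: less_Suc_eq)
      then have "e' ` I = e ` I" "e' ` ({..<Suc n} - I) = insert z (e ` ({..<n} - I))"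
        using im[of I] im[of "{..<n} - I"] by (auto simp: e'_def)
      then show ?thesis using Z'(3)[of "e ` I" "e ` ({..<n} - I)" z] J(1) z(1) by (simp add: \<P>_def)
    qed
    moreover have "e' i \<in> Z \<and> e' i \<notin> span (e' ` {..<i})" if "i < Suc n" for i
      using e' that z Z'(2) im[of "{..<n}"] by (cases "i = n") (auto simp: admissible_def e'_def)
    ultimately have "admissible (Suc n) e'" by (simp add: admissible_def)
    then show "\<exists>r. admissible (Suc n) (e(n := r))" unfolding e'_def by blast
  qed
  then obtain e where e: "\<And>n. admissible (Suc n) e" by auto
  have "rejects \<epsilon> (e ` I) (e ` ({..<n} - I)) Z" if "I \<subseteq> {..<n}" for n I
    using e[of "n - 1"] that assms by (cases n) (auto simp: admissible_def)
  moreover have "e n \<in> Z \<and> e n \<notin> span (e ` {..<n})" for n using e[of n] by (simp add: admissible_def)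
  ultimately show ?thesis by (intro that[of e]) auto
qed

end

subsection \<open>Direct sums and perturbation\<close>

context normed_space_over
begin

lemma bounded_bilinear_scale: "bounded_bilinear (*k)"
proof
  show "\<exists>K. \<forall>c x. norm (c *k x) \<le> norm c * norm x * K"
    by (rule exI[of _ 1]) (simp add: norm_scale)
qed (simp_all add: scale_left_distrib scale_right_distrib scaleR_left_scale scale_scaleR)

lemmas tendsto_scale = bounded_bilinear.tendsto[OF bounded_bilinear_scale]

text \<open>Stated for maps linear on \<open>U\<close> alone, since an isomorphism of a direct sum
  is linear only on its domain. Injectivity carries a free sequence in \<open>U\<close> to a free
  one.\<close>

lemma infinite_dimensional_injective_image:
  assumes U: "subspace U" "infinite_dimensional U" and inj: "inj_on h U"
    and add: "\<And>x y. x \<in> U \<Longrightarrow> y \<in> U \<Longrightarrow> h (x + y) = h x + h y"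
    and scale: "\<And>c x. x \<in> U \<Longrightarrow> h (c *k x) = c *k h x"
  shows "subspace (h ` U)" "infinite_dimensional (h ` U)"
proof -
  have sub: "subspace (h ` S)" if S: "subspace S" "S \<subseteq> U" for S
    unfolding subspace_def
  proof (intro conjI ballI allI)
    have "h (0 *k 0) = 0 *k h 0" using S subspace_0 by (intro scale) auto
    then show "0 \<in> h ` S" using subspace_0[OF S(1)] by (intro image_eqI[of _ _ 0]) auto
  next
    fix x y assume "x \<in> h ` S" "y \<in> h ` S"
    then obtain x' y' where "x = h x'" "y = h y'" "x' \<in> S" "y' \<in> S" by auto
    then show "x + y \<in> h ` S" using S(2) add[of x' y'] subspace_add[OF S(1), of x' y']
      by (intro image_eqI[of _ _ "x' + y'"]) (auto simp: subset_iff)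
  next
    fix c x assume "x \<in> h ` S"
    then obtain x' where "x = h x'" "x' \<in> S" by auto
    then show "c *k x \<in> h ` S" using S(2) scale[of x' c] subspace_scale[OF S(1), of x' c]
      by (intro image_eqI[of _ _ "c *k x'"]) (auto simp: subset_iff)
  qed
  then show "subspace (h ` U)" using U by blast
  obtain u where u: "\<And>n::nat. u n \<in> U" "\<And>n. u n \<notin> span (u ` {..<n})"
    using free_sequence_exists[of "\<lambda>_. U"] U(2) by blast
  have "h (u n) \<notin> span ((\<lambda>n. h (u n)) ` {..<n})" for n
  proof
    let ?S = "span (u ` {..<n})"
    have S: "?S \<subseteq> U" using u(1) U(1) by (intro span_minimal) auto
    assume "h (u n) \<in> span ((\<lambda>n. h (u n)) ` {..<n})"
    moreover have "span ((\<lambda>n. h (u n)) ` {..<n}) \<subseteq> h ` ?S"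
      using span_superset[of "u ` {..<n}"] by (intro span_minimal sub S) auto
    ultimately obtain w where "w \<in> ?S" "h (u n) = h w" by blast
    then have "u n = w" using inj_onD[OF inj] u(1) S by blast
    then show False using \<open>w \<in> ?S\<close> u(2) by blast
  qed
  then have "infinite_dimensional (range (\<lambda>n. h (u n)))" by (rule infinite_dimensional_free_sequence)
  then show "infinite_dimensional (h ` U)" by (rule infinite_dimensional_mono) (use u(1) in auto)
qed

text \<open>\<open>U'\<close> and \<open>V'\<close> are the images of the summands. The vectors
  \<open>(u, v)\<close> and \<open>(u, - v)\<close> have equal norm, so boundedness of
  \<open>f\<close> and of its inverse compares \<open>f (u, v)\<close> with
  \<open>f (u, - v)\<close>, the sum and the difference of the images.\<close>

lemma direct_sum_separated:
  assumes W: "isomorphic_to_direct_sum W U V"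
    and U: "subspace U" "infinite_dimensional U" and V: "subspace V" "infinite_dimensional V"
  obtains U' V' c where "subspace U'" "infinite_dimensional U'" "U' \<subseteq> W"
    "subspace V'" "infinite_dimensional V'" "V' \<subseteq> W" "c > 0"
    "\<And>x y. x \<in> U' \<Longrightarrow> y \<in> V' \<Longrightarrow> norm (x + y) \<le> c * norm (x - y)"
proof -
  obtain f g where hom: "homeomorphism (U \<times> V) W f g"
    and add: "\<And>p q. p \<in> U \<times> V \<Longrightarrow> q \<in> U \<times> V \<Longrightarrow> f (p + q) = f p + f q"
    and scale: "\<And>c u v. u \<in> U \<Longrightarrow> v \<in> V \<Longrightarrow> f (c *k u, c *k v) = c *k f (u, v)"
    using W unfolding isomorphic_to_direct_sum_def by blast
  have gf: "g (f p) = p" if "p \<in> U \<times> V" for p using hom that by (simp add: homeomorphism_apply1)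
  have fg: "f (g w) = w" "g w \<in> U \<times> V" if "w \<in> W" for w
    using hom that by (auto simp: homeomorphism_def)
  have fW: "f p \<in> W" if "p \<in> U \<times> V" for p using hom that by (auto simp: homeomorphism_def)
  have UV0: "0 \<in> U" "0 \<in> V" using U V subspace_0 by auto
  have UVr: "r *\<^sub>R p \<in> U \<times> V" if "p \<in> U \<times> V" for r p
    using that U(1) V(1) subspace_scaleR by (auto simp: mem_Times_iff)
  have fr: "f (r *\<^sub>R p) = r *\<^sub>R f p" if "p \<in> U \<times> V" for r p
    using scale[of "fst p" "snd p" "of_real r"] that
    by (cases p) (auto simp: scale_of_real)
  have Wr: "r *\<^sub>R w \<in> W" "g (r *\<^sub>R w) = r *\<^sub>R g w" if "w \<in> W" for r w
    using fr[OF fg(2)[OF that], of r] fg(1)[OF that] UVr[OF fg(2)[OF that], of r] fW gf by metis+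
  obtain M where M: "M > 0" "\<And>p. p \<in> U \<times> V \<Longrightarrow> norm (f p) \<le> M * norm p"
    by (rule continuous_homogeneous_bounded[of "U \<times> V" f])
      (use hom UV0 UVr fr in \<open>auto simp: homeomorphism_def zero_prod_def\<close>)
  have W0: "0 \<in> W" using Wr(1)[OF fW[of 0], of 0] UV0 by (simp add: zero_prod_def)
  obtain L where L: "L > 0" "\<And>w. w \<in> W \<Longrightarrow> norm (g w) \<le> L * norm w"
    by (rule continuous_homogeneous_bounded[of W g])
      (use hom W0 Wr in \<open>auto simp: homeomorphism_def\<close>)
  have inj: "inj_on f (U \<times> V)" using gf by (metis inj_onI)
  have fU: "subspace ((\<lambda>u. f (u, 0)) ` U)" "infinite_dimensional ((\<lambda>u. f (u, 0)) ` U)"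
  proof -
    have *: "inj_on (\<lambda>u. f (u, 0)) U" using inj UV0 by (auto simp: inj_on_def)
    have **: "f (x + y, 0) = f (x, 0) + f (y, 0)" if "x \<in> U" "y \<in> U" for x y
      using add[of "(x, 0)" "(y, 0)"] that UV0 by simp
    have ***: "f (c *k x, 0) = c *k f (x, 0)" if "x \<in> U" for c x
      using scale[of x 0 c] that UV0 by simp
    show "subspace ((\<lambda>u. f (u, 0)) ` U)" "infinite_dimensional ((\<lambda>u. f (u, 0)) ` U)"
      using infinite_dimensional_injective_image[OF U *] ** *** by blast+
  qed
  have fV: "subspace ((\<lambda>v. f (0, v)) ` V)" "infinite_dimensional ((\<lambda>v. f (0, v)) ` V)"
  proof -
    have *: "inj_on (\<lambda>v. f (0, v)) V" using inj UV0 by (auto simp: inj_on_def)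
    have **: "f (0, x + y) = f (0, x) + f (0, y)" if "x \<in> V" "y \<in> V" for x y
      using add[of "(0, x)" "(0, y)"] that UV0 by simp
    have ***: "f (0, c *k x) = c *k f (0, x)" if "x \<in> V" for c x
      using scale[of 0 x c] that UV0 by simp
    show "subspace ((\<lambda>v. f (0, v)) ` V)" "infinite_dimensional ((\<lambda>v. f (0, v)) ` V)"
      using infinite_dimensional_injective_image[OF V *] ** *** by blast+
  qed
  have sep: "norm (f (u, 0) + f (0, v)) \<le> (M * L) * norm (f (u, 0) - f (0, v))" if uv: "u \<in> U" "v \<in> V" for u v
  proof -
    have mv: "- v \<in> V" using uv V subspace_neg by blast
    have sum: "f (u, 0) + f (0, v') = f (u, v')" if "v' \<in> V" for v'
      using add[of "(u, 0)" "(0, v')"] uv that UV0 by simp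
    have "f (0, - v) = - f (0, v)" using fr[of "(0, v)" "-1"] uv UV0 by simp
    then have diff: "f (u, 0) - f (0, v) = f (u, - v)" using sum[OF mv] by simp
    have "norm (f (u, v)) \<le> M * norm (u, - v)" using M(2)[of "(u, v)"] uv by (simp add: norm_Pair)
    also have "norm (u, - v) \<le> L * norm (f (u, - v))"
      using L(2)[OF fW, of "(u, -v)"] gf[of "(u, - v)"] uv mv by simp
    finally show ?thesis using M by (simp add: sum uv diff mult.assoc)
  qed
  show ?thesis
  proof (rule that[OF fU _ fV])
    show "M * L > 0" using M L by simp
    show "norm (x + y) \<le> (M * L) * norm (x - y)"
      if "x \<in> (\<lambda>u. f (u, 0)) ` U" "y \<in> (\<lambda>v. f (0, v)) ` V" for x y
      using that sep by blast
  qed (use fW UV0 in auto)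
qed

end

context countable_dense_subfield
begin

lemma approximating_scalars:
  obtains d where "\<And>n. d n \<in> D" "d \<longlonglongrightarrow> c"
  using dense_D closure_sequential[of c D] by auto

text \<open>Density of \<open>D\<close> lets an arbitrary scalar be approximated along with the
  vector.\<close>

lemma subspace_closure_dsub:
  assumes Z: "dsub Z"
  shows "subspace (closure Z)"
  unfolding subspace_def
proof (intro conjI ballI allI)
  show "0 \<in> closure Z" using dsubD(1)[OF Z] closure_subset by blast
next
  fix x y assume "x \<in> closure Z" "y \<in> closure Z"
  then obtain f g where fg: "\<And>n. f n \<in> Z" "f \<longlonglongrightarrow> x" "\<And>n. g n \<in> Z" "g \<longlonglongrightarrow> y"
    unfolding closure_sequential by blast
  have "(\<lambda>n. f n + g n) \<longlonglongrightarrow> x + y" by (intro tendsto_add fg)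
  then show "x + y \<in> closure Z"
    using fg dsubD(2)[OF Z] by (auto simp: closure_sequential intro!: exI[of _ "\<lambda>n. f n + g n"])
next
  fix c x assume "x \<in> closure Z"
  then obtain f where f: "\<And>n. f n \<in> Z" "f \<longlonglongrightarrow> x" unfolding closure_sequential by blast
  obtain d where d: "\<And>n. d n \<in> D" "d \<longlonglongrightarrow> c" using approximating_scalars by blast
  have "(\<lambda>n. d n *k f n) \<longlonglongrightarrow> c *k x" by (intro tendsto_scale f d)
  then show "c *k x \<in> closure Z"
    using f d dsubD(3)[OF Z] by (auto simp: closure_sequential intro!: exI[of _ "\<lambda>n. d n *k f n"])
qed

text \<open>Vectors of \<open>Z\<close> approximate a sequence of \<open>U\<close> with bounded
  coordinates; equal coefficients then give nearby combinations. Coefficients from \<open>D\<close>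
  keep the new span inside \<open>Z\<close>.\<close>

lemma big_perturbation:
  assumes U: "subspace U" "infinite_dimensional U" "U \<subseteq> closure Z" and Z: "dsub Z"
    and \<eta>: "0 < \<eta>" "\<eta> < 1"
  obtains U' where "big U'" "U' \<subseteq> Z" "\<And>x'. x' \<in> U' \<Longrightarrow> \<exists>x\<in>U. norm (x - x') \<le> \<eta> * norm x"
proof -
  obtain u where u: "\<And>n::nat. u n \<in> U"
    and coord: "\<And>a n N. n < N \<Longrightarrow> norm (a n) \<le> 2 ^ n * norm (\<Sum>i<N. a i *k u i)"
    using bounded_coordinates[OF U(1,2)] by metis
  have "\<exists>w\<in>Z. dist w (u n) < \<eta> / 4 ^ Suc n" for n
  proof -
    have "u n \<in> closure Z" "\<eta> / 4 ^ Suc n > 0" using u[of n] U(3) \<eta> by auto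
    then show ?thesis unfolding closure_approachable by blast
  qed
  then obtain w where w: "\<And>n. w n \<in> Z" "\<And>n. dist (w n) (u n) < \<eta> / 4 ^ Suc n" by metis
  have close: "norm (u n - w n) \<le> \<eta> / 4 ^ Suc n" for n
    using less_imp_le[OF w(2)[of n]] by (simp add: dist_norm norm_minus_commute)
  have "\<exists>x\<in>U. norm (x - x') \<le> \<eta> * norm x" if x': "x' \<in> dspan (range w)" for x'
  proof -
    obtain a N where x': "x' = (\<Sum>i<N. a i *k w i)" using dspan_range_sum[OF x'] by metis
    have "(\<Sum>i<N. a i *k u i) \<in> U" using u U(1) by (intro subspace_sum subspace_scale) auto
    then show ?thesis using perturbation_bound[where N = N and a = a, OF coord close] x' by blast
  qed
  moreover have "big (dspan (range w))"
    using big_dspan[OF infinite_dimensional_perturbation[OF coord close \<eta>(2)]] .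
  moreover have "dspan (range w) \<subseteq> Z" using w(1) Z by (intro dspan_minimal) auto
  ultimately show ?thesis using that by blast
qed

lemma hereditarily_indecomposable_closure:
  assumes Z: "big Z" and acc: "\<And>n. accepts (1 / real (Suc n)) {} {} Z"
  shows "hereditarily_indecomposable (closure Z)"
  unfolding hereditarily_indecomposable_def
proof
  assume "\<exists>W U V. subspace W \<and> W \<subseteq> closure Z \<and> infinite_dimensional W \<and>
    subspace U \<and> U \<subseteq> closure Z \<and> infinite_dimensional U \<and>
    subspace V \<and> V \<subseteq> closure Z \<and> infinite_dimensional V \<and> isomorphic_to_direct_sum W U V"
  then obtain W U V where W: "W \<subseteq> closure Z" "isomorphic_to_direct_sum W U V"
    and UV: "subspace U" "infinite_dimensional U" "subspace V" "infinite_dimensional V" by blast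
  obtain U1 V1 c where U1: "subspace U1" "infinite_dimensional U1" "U1 \<subseteq> W"
    and V1: "subspace V1" "infinite_dimensional V1" "V1 \<subseteq> W" and c: "c > 0"
    and sep: "\<And>x y. x \<in> U1 \<Longrightarrow> y \<in> V1 \<Longrightarrow> norm (x + y) \<le> c * norm (x - y)"
    using direct_sum_separated[OF W(2) UV] by metis
  \<comment> \<open>Both \<open>2 * norm x\<close> and \<open>2 * norm y\<close> are at most
    \<open>norm (x + y) + norm (x - y)\<close>, hence at most \<open>M * norm (x - y)\<close>. The
    choice of \<open>\<eta>\<close> then keeps the total perturbation within half of
    \<open>norm (x - y)\<close>.\<close>
  define M where "M = 1 + c"
  define \<eta> where "\<eta> = 1 / (2 * M)"
  have \<eta>: "0 < \<eta>" "\<eta> < 1" and M: "M > 1" using c by (auto simp: \<eta>_def M_def)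
  obtain U2 where U2: "big U2" "U2 \<subseteq> Z" "\<And>x'. x' \<in> U2 \<Longrightarrow> \<exists>x\<in>U1. norm (x - x') \<le> \<eta> * norm x"
    using big_perturbation[of U1 Z \<eta>] U1 W Z \<eta> by (metis order_trans)
  obtain V2 where V2: "big V2" "V2 \<subseteq> Z" "\<And>x'. x' \<in> V2 \<Longrightarrow> \<exists>x\<in>V1. norm (x - x') \<le> \<eta> * norm x"
    using big_perturbation[of V1 Z \<eta>] V1 W Z \<eta> by (metis order_trans)
  \<comment> \<open>Separation survives the perturbation with constant \<open>2 * M\<close>, the
    inverse of \<open>\<eta>\<close>; acceptance at a value below \<open>\<eta>\<close> contradicts
    it.\<close>
  obtain n where n: "1 / real (Suc n) < \<eta>" using nat_approx_posE[OF \<eta>(1)] by blast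
  obtain x' y' where xy': "x' \<in> U2" "y' \<in> V2" "norm (x' - y') < 1 / real (Suc n) * norm (x' + y')"
    using acc[of n] U2 V2 dspan_eq unfolding accepts_def by (metis Un_empty_left)
  obtain x y where x: "x \<in> U1" "norm (x - x') \<le> \<eta> * norm x" and y: "y \<in> V1" "norm (y - y') \<le> \<eta> * norm y"
    using U2(3) V2(3) xy' by blast
  have le: "norm (x + y) \<le> c * norm (x - y)" using sep x y by blast
  have "2 * norm x = norm ((x + y) + (x - y))"
    by (simp flip: scaleR_2)
  then have nx: "2 * norm x \<le> M * norm (x - y)"
    using norm_triangle_ineq[of "x + y" "x - y"] le by (simp add: M_def algebra_simps)
  have "2 * norm y = norm ((x + y) - (x - y))"
    by (simp flip: scaleR_2)
  then have ny: "2 * norm y \<le> M * norm (x - y)"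
    using norm_triangle_ineq4[of "x + y" "x - y"] le by (simp add: M_def algebra_simps)
  have "norm (x - x') + norm (y - y') \<le> \<eta> * (norm x + norm y)" using x y by (simp add: algebra_simps)
  also have "\<dots> \<le> \<eta> * (M * norm (x - y))" using nx ny \<eta> by (intro mult_left_mono) auto
  finally have err: "norm (x - x') + norm (y - y') \<le> norm (x - y) / 2" using M by (simp add: \<eta>_def)
  have "norm (x - y) \<le> norm (x' - y') + (norm (x - x') + norm (y - y'))"
    by norm
  then have lower: "norm (x - y) \<le> 2 * norm (x' - y')" using err by linarith
  have "norm (x' + y') \<le> norm (x + y) + (norm (x - x') + norm (y - y'))"
    by norm
  also have "\<dots> \<le> M * norm (x - y)" using err le norm_ge_zero[of "x - y"] unfolding M_def ring_distribs by linarith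
  also have "\<dots> \<le> M * (2 * norm (x' - y'))" using lower M by (intro mult_left_mono) auto
  finally have "\<eta> * norm (x' + y') \<le> norm (x' - y')" using M by (simp add: \<eta>_def field_simps)
  moreover have "1 / real (Suc n) * norm (x' + y') \<le> \<eta> * norm (x' + y')"
    using n by (intro mult_right_mono) auto
  ultimately show False using xy'(3) by linarith
qed

end

section \<open>From rejected splittings to sign changes\<close>

context decided_subspace
begin

text \<open>The indices of sign 1 and of sign -1 form a rejected splitting; the two partial sums
  have the plain sum as their sum and the signed sum as their difference. Rejection sees
  coefficients in \<open>D\<close>, and density extends the bound to all of
  \<open>'k\<close>.\<close>

lemma sign_change_bound:
  assumes e: "\<And>n I. I \<subseteq> {..<n} \<Longrightarrow> rejects \<epsilon> (e ` I) (e ` ({..<n} - I)) Z"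
    and \<sigma>: "range \<sigma> \<subseteq> {-1, 1}"
  shows "\<epsilon> * norm (\<Sum>i<n::nat. a i *k e i) \<le> norm (\<Sum>i<n. (\<sigma> i * a i) *k e i)"
proof -
  have *: "\<epsilon> * norm (\<Sum>i<n::nat. b i *k e i) \<le> norm (\<Sum>i<n. (\<sigma> i * b i) *k e i)"
    if b: "\<And>i. b i \<in> D" for b
  proof -
    define I where "I = {i. i < n \<and> \<sigma> i = 1}"
    define x where "x = (\<Sum>i\<in>I. b i *k e i)"
    define y where "y = (\<Sum>i\<in>{..<n} - I. b i *k e i)"
    have I: "I \<subseteq> {..<n}" by (auto simp: I_def)
    have neg: "\<sigma> i = -1" if "i \<in> {..<n} - I" for i
      using that \<sigma> by (auto simp: I_def image_subset_iff)
    have "x \<in> dspan (e ` I)"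
      unfolding x_def by (rule sum_in_dsub) (use b dspan_superset[of "e ` I"] in auto)
    moreover have "y \<in> dspan (e ` ({..<n} - I))"
      unfolding y_def by (rule sum_in_dsub) (use b dspan_superset[of "e ` ({..<n} - I)"] in auto)
    ultimately have "\<epsilon> * norm (x + y) \<le> norm (x - y)" using rejects_norm_ge[OF e[OF I] big_Z] by blast
    moreover have "(\<Sum>i<n. b i *k e i) = x + y"
      unfolding x_def y_def by (rule sum.subset_diff[OF I finite_lessThan, THEN trans]) (rule add.commute)
    moreover have "(\<Sum>i<n. (\<sigma> i * b i) *k e i) = x - y"
    proof -
      have "(\<Sum>i<n. (\<sigma> i * b i) *k e i) =
          (\<Sum>i\<in>{..<n} - I. (\<sigma> i * b i) *k e i) + (\<Sum>i\<in>I. (\<sigma> i * b i) *k e i)"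
        by (rule sum.subset_diff[OF I finite_lessThan])
      also have "(\<Sum>i\<in>{..<n} - I. (\<sigma> i * b i) *k e i) = - y"
        unfolding y_def sum_negf[symmetric] using neg by (intro sum.cong) auto
      also have "(\<Sum>i\<in>I. (\<sigma> i * b i) *k e i) = x"
        unfolding x_def by (intro sum.cong) (auto simp: I_def)
      finally show ?thesis by simp
    qed
    ultimately show ?thesis by simp
  qed
  have "\<exists>d. (\<forall>k. d k \<in> D) \<and> d \<longlonglongrightarrow> a i" for i using approximating_scalars by metis
  then obtain d where d: "\<And>i k. d i k \<in> D" "\<And>i. d i \<longlonglongrightarrow> a i" by metis
  have "(\<lambda>k. \<epsilon> * norm (\<Sum>i<n. d i k *k e i)) \<longlonglongrightarrow> \<epsilon> * norm (\<Sum>i<n. a i *k e i)"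
    by (intro tendsto_intros tendsto_scale d)
  moreover have "(\<lambda>k. norm (\<Sum>i<n. (\<sigma> i * d i k) *k e i)) \<longlonglongrightarrow> norm (\<Sum>i<n. (\<sigma> i * a i) *k e i)"
    by (intro tendsto_intros tendsto_scale d)
  ultimately show ?thesis using *[OF d(1)] by (intro LIMSEQ_le) auto
qed

end

subsection \<open>Unconditional bases from sign changes\<close>

locale banach_space_over = normed_space_over scale
  for scale :: "'k::{real_normed_field,euclidean_space} \<Rightarrow> 'a::banach \<Rightarrow> 'a"
    (infixr \<open>*k\<close> 75)
begin

text \<open>Sign changes bound the partial sums: the plain sum plus the sum with signs flipped from
  index \<open>m\<close> on is twice the \<open>m\<close>-th partial sum. Bounded partial sums give
  convergent, unique expansions throughout the closure.\<close>

lemma unconditional_basis_of_closed_span: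
  fixes e :: "nat \<Rightarrow> 'a"
  assumes e0: "\<And>n. e n \<noteq> 0"
    and sign: "\<And>\<sigma> a n. range \<sigma> \<subseteq> {-1, 1} \<Longrightarrow>
      norm (\<Sum>i<n. (\<sigma> i * a i) *k e i) \<le> C * norm (\<Sum>i<n. a i *k e i)"
  shows "has_unconditional_basis (closure (span (range e)))"
proof -
  have C: "C \<ge> 0"
  proof -
    have "0 \<le> C * norm (e 0)"
      using order_trans[OF norm_ge_zero sign[where \<sigma> = "\<lambda>_. 1" and n = 1 and a = "\<lambda>_. 1"]] by simp
    then show ?thesis using e0[of 0] by (simp add: zero_le_mult_iff)
  qed
  define K where "K = 1 + C"
  have K: "K > 0" using C by (simp add: K_def)
  have part: "norm (\<Sum>i<m. a i *k e i) \<le> K * norm (\<Sum>i<n. a i *k e i)" if "m \<le> n" for a m n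
  proof -
    define \<sigma> where "\<sigma> i = (if i < m then 1 else -1 :: 'k)" for i
    define x where "x = (\<Sum>i<n. a i *k e i)"
    have "2 *\<^sub>R (\<Sum>i<m. a i *k e i) = (\<Sum>i<n. 2 *\<^sub>R ((if i < m then a i else 0) *k e i))"
      using sum_pad[OF that, of a e] by (simp add: scaleR_sum_right)
    also have "\<dots> = (\<Sum>i<n. a i *k e i + (\<sigma> i * a i) *k e i)"
      by (intro sum.cong) (auto simp: \<sigma>_def scaleR_2)
    also have "\<dots> = x + (\<Sum>i<n. (\<sigma> i * a i) *k e i)" by (simp add: sum.distrib x_def)
    finally have "norm (2 *\<^sub>R (\<Sum>i<m. a i *k e i)) \<le> norm x + norm (\<Sum>i<n. (\<sigma> i * a i) *k e i)"
      by (simp add: norm_triangle_ineq)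
    moreover have "range \<sigma> \<subseteq> {-1, 1}" by (auto simp: \<sigma>_def)
    then have "norm (\<Sum>i<n. (\<sigma> i * a i) *k e i) \<le> C * norm x" unfolding x_def by (rule sign)
    ultimately have "norm (2 *\<^sub>R (\<Sum>i<m. a i *k e i)) \<le> norm x + C * norm x" by simp
    then have "2 * norm (\<Sum>i<m. a i *k e i) \<le> K * norm x" by (simp add: K_def algebra_simps)
    then show ?thesis using norm_ge_zero[of "\<Sum>i<m. a i *k e i"] unfolding x_def by linarith
  qed
  have coord: "norm (a m) * norm (e m) \<le> 2 * K * norm (\<Sum>i<n. a i *k e i)" if "m < n" for a m n
  proof -
    have "a m *k e m = (\<Sum>i<Suc m. a i *k e i) - (\<Sum>i<m. a i *k e i)" by simp
    then have "norm (a m) * norm (e m) \<le> norm (\<Sum>i<Suc m. a i *k e i) + norm (\<Sum>i<m. a i *k e i)"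
      using norm_triangle_ineq4 by (metis norm_scale)
    then show ?thesis using part[of "Suc m" n a] part[of m n a] that by linarith
  qed
  have ex: "\<exists>a. (\<lambda>n. a n *k e n) sums y" if y: "y \<in> closure (span (range e))" for y
  proof -
    obtain f where f: "\<And>k::nat. f k \<in> span (range e)" "f \<longlonglongrightarrow> y"
      using y unfolding closure_sequential by blast
    have "\<exists>b N. f k = (\<Sum>i<N. b i *k e i)" for k using span_range_sum[OF f(1)] by metis
    then obtain b' N where b': "\<And>k. f k = (\<Sum>i<N k. b' k i *k e i)" by metis
    \<comment> \<open>Padding by zeros makes \<open>f k\<close> a combination of every sufficiently
      large length, so the coefficients of different \<open>f k\<close> can be compared.\<close>
    define b where "b k i = (if i < N k then b' k i else 0)" for k i
    have fb: "f k = (\<Sum>i<n. b k i *k e i)" if "N k \<le> n" for k n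
      using b'[of k] sum_pad[OF that, of "b' k" e] by (simp add: b_def)
    have diff: "(\<Sum>i<n. (b j i - b k i) *k e i) = f j - f k" if "max (N j) (N k) \<le> n" for j k n
      using that fb[of j n] fb[of k n] by (simp add: scale_left_diff_distrib sum_subtractf)
    have "Cauchy (\<lambda>k. b k i)" for i
    proof (rule metric_CauchyI)
      fix r :: real assume r: "r > 0"
      define s where "s = r * norm (e i) / (2 * K)"
      have "s > 0" using r K e0 by (simp add: s_def)
      then obtain N0 where N0: "\<And>j k. j \<ge> N0 \<Longrightarrow> k \<ge> N0 \<Longrightarrow> dist (f j) (f k) < s"
        using LIMSEQ_imp_Cauchy[OF f(2)] unfolding Cauchy_def by blast
      have "dist (b j i) (b k i) < r" if "j \<ge> N0" "k \<ge> N0" for j k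
      proof -
        let ?n = "max (Suc i) (max (N j) (N k))"
        have "norm (b j i - b k i) * norm (e i) \<le> 2 * K * norm (f j - f k)"
          using coord[of i ?n "\<lambda>i. b j i - b k i"] diff[of j k ?n] by simp
        also have "\<dots> < 2 * K * s" using N0[OF that] K by (simp add: dist_norm)
        also have "\<dots> = r * norm (e i)" using K by (simp add: s_def)
        finally show ?thesis using e0[of i] by (simp add: dist_norm)
      qed
      then show "\<exists>M. \<forall>m\<ge>M. \<forall>n\<ge>M. dist (b m i) (b n i) < r" by blast
    qed
    then have "\<exists>a. (\<lambda>k. b k i) \<longlonglongrightarrow> a" for i by (simp add: Cauchy_convergent_iff convergent_def)
    then obtain a where a: "\<And>i. (\<lambda>k. b k i) \<longlonglongrightarrow> a i" by metis
    \<comment> \<open>Letting \<open>j\<close> tend to infinity for fixed \<open>k\<close> and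
      \<open>n\<close> transfers the estimate for \<open>f j - f k\<close> to the limit coefficients
      \<open>a\<close>. It is uniform in \<open>n \<ge> N k\<close>, which yields convergence to
      \<open>y\<close>.\<close>
    have bound: "norm ((\<Sum>i<n. a i *k e i) - y) \<le> (K + 1) * norm (y - f k)" if "N k \<le> n" for k n
    proof -
      have "norm ((\<Sum>i<n. b j i *k e i) - f k) \<le> K * norm (f j - f k)" for j
      proof -
        let ?n = "max n (max (N j) (N k))"
        have "(\<Sum>i<n. (b j i - b k i) *k e i) = (\<Sum>i<n. b j i *k e i) - f k"
          using fb[OF that] by (simp add: scale_left_diff_distrib sum_subtractf)
        then show ?thesis using part[of n ?n "\<lambda>i. b j i - b k i"] diff[of j k ?n] by simp
      qed
      moreover have "(\<lambda>j. norm ((\<Sum>i<n. b j i *k e i) - f k)) \<longlonglongrightarrow> norm ((\<Sum>i<n. a i *k e i) - f k)"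
        by (intro tendsto_intros tendsto_scale a)
      moreover have "(\<lambda>j. K * norm (f j - f k)) \<longlonglongrightarrow> K * norm (y - f k)"
        by (intro tendsto_intros f)
      ultimately have "norm ((\<Sum>i<n. a i *k e i) - f k) \<le> K * norm (y - f k)"
        by (intro LIMSEQ_le) auto
      moreover have "norm ((\<Sum>i<n. a i *k e i) - y) \<le> norm ((\<Sum>i<n. a i *k e i) - f k) + norm (y - f k)"
        by norm
      ultimately show ?thesis by (simp add: algebra_simps)
    qed
    have "(\<lambda>n. \<Sum>i<n. a i *k e i) \<longlonglongrightarrow> y"
    proof (rule LIMSEQ_I)
      fix r :: real assume r: "r > 0"
      then have "r / (K + 1) > 0" using K by simp
      then obtain k where "dist (f k) y < r / (K + 1)"
        using f(2) unfolding lim_sequentially by blast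
      then have "(K + 1) * norm (y - f k) < r"
        using K by (simp add: dist_norm norm_minus_commute less_divide_eq mult.commute)
      then show "\<exists>no. \<forall>n\<ge>no. norm ((\<Sum>i<n. a i *k e i) - y) < r"
        using bound[of k] by (meson le_less_trans)
    qed
    then show ?thesis unfolding sums_def by blast
  qed
  have uniq: "a = a'" if "(\<lambda>n. a n *k e n) sums y" "(\<lambda>n. a' n *k e n) sums y" for a a' y
  proof
    fix m
    have "(\<lambda>n. (a n - a' n) *k e n) sums 0"
      using sums_diff[OF that] by (simp add: scale_left_diff_distrib)
    then have "(\<lambda>n. 2 * K * norm (\<Sum>i<n. (a i - a' i) *k e i)) \<longlonglongrightarrow> 2 * K * norm (0::'a)"
      unfolding sums_def by (intro tendsto_intros)
    moreover have "\<exists>N. \<forall>n\<ge>N. norm (a m - a' m) * norm (e m) \<le> 2 * K * norm (\<Sum>i<n. (a i - a' i) *k e i)"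
      using coord[of m _ "\<lambda>i. a i - a' i"] by (intro exI[of _ "Suc m"]) auto
    ultimately have "norm (a m - a' m) * norm (e m) \<le> 2 * K * norm (0::'a)"
      by (rule LIMSEQ_le_const)
    then show "a m = a' m" using e0[of m] by (simp add: mult_le_0_iff)
  qed
  have "schauder_basis (closure (span (range e))) e"
    unfolding schauder_basis_def
  proof (intro conjI ballI)
    show "range e \<subseteq> closure (span (range e))"
      using span_superset[of "range e"] closure_subset[of "span (range e)"] by blast
    show "\<exists>!a. (\<lambda>n. a n *k e n) sums y" if "y \<in> closure (span (range e))" for y
      using ex[OF that] uniq by metis
  qed
  moreover have "unconditional e"
    unfolding unconditional_def
  proof (intro exI[of _ C] allI impI)
    fix a \<sigma> :: "nat \<Rightarrow> 'k" assume sum: "summable (\<lambda>n. a n *k e n)" and \<sigma>: "range \<sigma> \<subseteq> {-1, 1 :: 'k}"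
    \<comment> \<open>Zeroing the coefficients below \<open>m\<close> transfers the sign bound to
      blocks; the Cauchy criterion then gives convergence of the signed series.\<close>
    have block: "norm (\<Sum>i=m..<n. (\<sigma> i * a i) *k e i) \<le> C * norm (\<Sum>i=m..<n. a i *k e i)" for m n :: nat
    proof -
      have *: "(\<Sum>i<n. (if m \<le> i then g i else 0)) = sum g {m..<n}" for g :: "nat \<Rightarrow> 'a"
      proof -
        have "{..<n} \<inter> {m..} = {m..<n}" by auto
        then show ?thesis using sum.inter_restrict[of "{..<n}" g "{m..}"] by simp
      qed
      have "(\<Sum>i<n. (\<sigma> i * (if m \<le> i then a i else 0)) *k e i) = (\<Sum>i=m..<n. (\<sigma> i * a i) *k e i)"
        unfolding *[of "\<lambda>i. (\<sigma> i * a i) *k e i", symmetric] by (intro sum.cong refl) simp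
      moreover have "(\<Sum>i<n. (if m \<le> i then a i else 0) *k e i) = (\<Sum>i=m..<n. a i *k e i)"
        unfolding *[of "\<lambda>i. a i *k e i", symmetric] by (intro sum.cong refl) simp
      ultimately show ?thesis using sign[OF \<sigma>, where n = n and a = "\<lambda>i. if m \<le> i then a i else 0"] by simp
    qed
    have sum': "summable (\<lambda>n. (\<sigma> n * a n) *k e n)"
      unfolding summable_Cauchy
    proof (intro allI impI)
      fix r :: real assume "r > 0"
      then have "r / K > 0" using K by simp
      then obtain N where N: "\<And>m n :: nat. m \<ge> N \<Longrightarrow> norm (\<Sum>i=m..<n. a i *k e i) < r / K"
        using sum unfolding summable_Cauchy by blast
      have "norm (\<Sum>i=m..<n. (\<sigma> i * a i) *k e i) < r" if "m \<ge> N" for m n :: nat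
      proof -
        have "C * norm (\<Sum>i=m..<n. a i *k e i) \<le> K * norm (\<Sum>i=m..<n. a i *k e i)"
          by (intro mult_right_mono) (auto simp: K_def)
        also have "\<dots> < r" using N[OF that] K by (simp add: less_divide_eq mult.commute)
        finally show ?thesis using block[of m n] by linarith
      qed
      then show "\<exists>N. \<forall>m\<ge>N. \<forall>n. norm (\<Sum>i=m..<n. (\<sigma> i * a i) *k e i) < r" by blast
    qed
    moreover have "norm (\<Sum>n. (\<sigma> n * a n) *k e n) \<le> C * norm (\<Sum>n. a n *k e n)"
      by (rule LIMSEQ_le[OF tendsto_norm[OF summable_LIMSEQ[OF sum']]
            tendsto_mult_left[OF tendsto_norm[OF summable_LIMSEQ[OF sum]]]])
        (use sign[OF \<sigma>] in auto)
    ultimately show "summable (\<lambda>n. (\<sigma> n * a n) *k e n) \<and>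
      norm (\<Sum>n. (\<sigma> n * a n) *k e n) \<le> C * norm (\<Sum>n. a n *k e n)" by blast
  qed
  ultimately show ?thesis unfolding has_unconditional_basis_def by blast
qed

end

subsection \<open>The dichotomy\<close>

lemma countable_dense_subfield_exists:
  obtains D :: "'k::{real_normed_field,euclidean_space} set" where "countable D" "closure D = UNIV"
    "1 \<in> D" "\<And>x y. x \<in> D \<Longrightarrow> y \<in> D \<Longrightarrow> x + y \<in> D" "\<And>x y. x \<in> D \<Longrightarrow> y \<in> D \<Longrightarrow> x * y \<in> D"
    "\<And>x. x \<in> D \<Longrightarrow> - x \<in> D" "\<And>x. x \<in> D \<Longrightarrow> inverse x \<in> D"
proof -
  obtain S :: "'k set" where S: "countable S" "\<And>X. open X \<Longrightarrow> X \<noteq> {} \<Longrightarrow> \<exists>d\<in>S. d \<in> X"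
    using countable_dense_exists by blast
  obtain D where D: "insert 1 S \<subseteq> D" "countable D"
    "\<And>f x y. f \<in> {(+), (*), (\<lambda>x y. - x), (\<lambda>x y. inverse x)} \<Longrightarrow> x \<in> D \<Longrightarrow> y \<in> D \<Longrightarrow> f x y \<in> D"
    by (rule countable_closed_superset[of "insert 1 S" "{(+), (*), (\<lambda>x y. - x), (\<lambda>x y. inverse x)}"])
      (use S(1) in auto)
  have "closure D = UNIV"
  proof -
    have "interior (- D) = {}" using S(2)[OF open_interior, of "- D"] D(1) interior_subset by blast
    then show ?thesis by (simp add: closure_interior)
  qed
  then show ?thesis using that[of D] D(1,2) D(3)[of "(+)"] D(3)[of "(*)"]
      D(3)[of "\<lambda>x y. - x"] D(3)[of "\<lambda>x y. inverse x"] by auto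
qed

theorem theorem1:
  fixes scale :: "'k::{real_normed_field,euclidean_space} \<Rightarrow> 'a::banach \<Rightarrow> 'a"
  assumes "normed_space_over scale"
    and "normed_space_over.infinite_dimensional scale (UNIV :: 'a set)"
  shows "\<exists>Y. module.subspace scale Y \<and> closed Y \<and>
           normed_space_over.infinite_dimensional scale Y \<and>
           (normed_space_over.has_unconditional_basis scale Y \<or>
            normed_space_over.hereditarily_indecomposable scale Y)"
proof -
  interpret normed_space_over scale by fact
  interpret banach_space_over scale ..
  obtain D :: "'k set" where D: "countable D" "closure D = UNIV"
    "1 \<in> D" "\<And>x y. x \<in> D \<Longrightarrow> y \<in> D \<Longrightarrow> x + y \<in> D" "\<And>x y. x \<in> D \<Longrightarrow> y \<in> D \<Longrightarrow> x * y \<in> D"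
    "\<And>x. x \<in> D \<Longrightarrow> - x \<in> D" "\<And>x. x \<in> D \<Longrightarrow> inverse x \<in> D"
    using countable_dense_subfield_exists by blast
  interpret countable_dense_subfield scale D by unfold_locales (fact D)+
  obtain z :: "nat \<Rightarrow> 'a" where z: "\<And>n. z n \<notin> span (z ` {..<n})"
    using free_sequence_exists[of "\<lambda>_. UNIV", OF assms(2)] by metis
  \<comment> \<open>The aim is a \<open>D\<close>-linear space containing a free sequence and still
    countable, so that only countably many pairs of finite sets have to be decided.\<close>
  let ?F = "insert (+) ((\<lambda>d x y. scale d x) ` D)"
  obtain G where G: "insert 0 (range z) \<subseteq> G" "countable G"
    "\<And>f x y. f \<in> ?F \<Longrightarrow> x \<in> G \<Longrightarrow> y \<in> G \<Longrightarrow> f x y \<in> G"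
    by (rule countable_closed_superset[of "insert 0 (range z)" ?F]) (use D(1) in auto)
  have "dsub G"
    unfolding dsub_def
  proof (intro conjI ballI)
    show "0 \<in> G" using G(1) by simp
    show "x + y \<in> G" if "x \<in> G" "y \<in> G" for x y using G(3)[of "(+)"] that by simp
    show "scale d x \<in> G" if "d \<in> D" "x \<in> G" for d x using G(3)[of "\<lambda>x y. scale d x" x x] that by simp
  qed
  moreover have "infinite_dimensional G"
    using infinite_dimensional_mono[OF infinite_dimensional_free_sequence[OF z]] G(1) by auto
  ultimately have bigG: "big G" by blast
  define Fin where "Fin = {A. finite A \<and> A \<subseteq> G}"
  \<comment> \<open>Including \<open>n\<close> in the index decides all tolerances
    \<open>1 / real (Suc n)\<close> in one and the same \<open>Z\<close>.\<close>
  define I where "I = (UNIV :: nat set) \<times> Fin \<times> Fin"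
  define P where "P = (\<lambda>(n, A, B). accepts (1 / real (Suc n)) A B)"
  have "countable I"
    unfolding I_def Fin_def by (intro countable_SIGMA countable_Collect_finite_subset G(2)) auto
  moreover have "P i Z'" if "big Z" "P i Z" "almost_contained Z' Z" for i Z Z'
    using that accepts_almost_contained by (auto simp: P_def split: prod.splits)
  ultimately obtain Z where Z: "big Z" "Z \<subseteq> G"
    and dec: "\<And>i. i \<in> I \<Longrightarrow> P i Z \<or> (\<forall>Z'. big Z' \<longrightarrow> Z' \<subseteq> Z \<longrightarrow> \<not> P i Z')"
    using stabilization[of I G P] bigG by metis
  have dec: "accepts (1 / real (Suc n)) A B Z \<or> rejects (1 / real (Suc n)) A B Z"
    if "finite A" "finite B" "A \<union> B \<subseteq> Z" for n A B
    using dec[of "(n, A, B)"] that Z(2) by (auto simp: I_def Fin_def P_def rejects_def)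
  show ?thesis
  proof (cases "\<forall>n. accepts (1 / real (Suc n)) {} {} Z")
    case True
    then have "hereditarily_indecomposable (closure Z)"
      using hereditarily_indecomposable_closure[OF Z(1)] by blast
    moreover have "infinite_dimensional (closure Z)"
      using infinite_dimensional_mono[OF _ closure_subset] Z(1) by blast
    ultimately show ?thesis using subspace_closure_dsub Z(1) closed_closure by blast
  next
    case False
    then obtain n where n: "rejects (1 / real (Suc n)) {} {} Z" using dec by blast
    define \<epsilon> where "\<epsilon> = 1 / real (Suc n)"
    interpret decided_subspace scale D \<epsilon> Z
      by unfold_locales (use Z(1) dec in \<open>auto simp: \<epsilon>_def\<close>)
    obtain e where e: "\<And>n::nat. e n \<notin> span (e ` {..<n})"
      "\<And>n I. I \<subseteq> {..<n} \<Longrightarrow> rejects \<epsilon> (e ` I) (e ` ({..<n} - I)) Z"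
      using all_splittings_rejected n unfolding \<epsilon>_def by metis
    have "norm (\<Sum>i<m. scale (\<sigma> i * a i) (e i)) \<le> (1 / \<epsilon>) * norm (\<Sum>i<m. scale (a i) (e i))"
      if \<sigma>: "range \<sigma> \<subseteq> {-1, 1}" for \<sigma> a m
    proof -
      \<comment> \<open>Sign changes are involutions, so \<open>sign_change_bound\<close> for the
        coefficients \<open>\<sigma> i * a i\<close> becomes an upper bound for the signed
        sum.\<close>
      have "\<sigma> i = -1 \<or> \<sigma> i = 1" for i using \<sigma> by (auto simp: image_subset_iff)
      then have "\<sigma> i * \<sigma> i = 1" for i by (rule disjE[of "\<sigma> i = -1" "\<sigma> i = 1"]) simp_all
      then have "\<sigma> i * (\<sigma> i * a i) = a i" for i by (simp flip: mult.assoc)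
      then have "\<epsilon> * norm (\<Sum>i<m. scale (\<sigma> i * a i) (e i)) \<le> norm (\<Sum>i<m. scale (a i) (e i))"
        using sign_change_bound[where n = m and a = "\<lambda>i. \<sigma> i * a i", OF e(2) \<sigma>]
        by (simp only: \<open>\<And>i. \<sigma> i * (\<sigma> i * a i) = a i\<close>)
      then show ?thesis by (simp add: \<epsilon>_def field_simps)
    qed
    moreover have "e n \<noteq> 0" for n using e(1)[of n] span_zero by metis
    ultimately have "has_unconditional_basis (closure (span (range e)))"
      using unconditional_basis_of_closed_span[of e "1 / \<epsilon>"] by blast
    moreover have "subspace (closure (span (range e)))"
      by (rule subspace_closure_dsub) (auto simp: dsub_def span_zero intro: span_add span_scale)
    moreover have "infinite_dimensional (closure (span (range e)))"
      using infinite_dimensional_mono[OF infinite_dimensional_free_sequence[OF e(1)]]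
        span_superset[of "range e"] closure_subset[of "span (range e)"] by blast
    ultimately show ?thesis using closed_closure by blast
  qed
qed

end
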